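(* Let $G$ be a one-ended, locally finite graph. If $\omega\cdot R$ is an asymptotic minor of $G$, then the half-grid is an asymptotic minor of $G$.
   Context: $\mathbb{N}$ includes $0$. A ray is a one-way infinite path. An end of a graph $G$ is an equivalence class of rays in $G$, where two rays are equivalent if there are infinitely many pairwise disjoint paths between them in $G$. A graph is one-ended if it has exactly one end. $\omega\cdot R$ denotes the disjoint union of countably infinitely many rays. The half-grid is the graph on $\mathbb{N}\times\mathbb{N}$ in which $(m,n)$ and $(m',n')$ are adjacent if and only if $|m-m'|+|n-n'|=1$. For sets $A,B$ of vertices (or subgraphs), $d_G(A,B)$ is the minimum distance in $G$ between an element of $A$ and an element of $B$. An $A$--$B$ path is a path meeting $A$ precisely in its first vertex and $B$ precisely in its last vertex. A model $(\mathcal V,\mathcal E)$ of a graph $X$ in a graph $G$ is a collection $\mathcal V$ of disjoint sets $V_x\subseteq V(G)$ for the vertices $x$ of $X$ such that each $G[V_x]$ is connected (the branch sets), and a collection $\mathcal E$ of internally disjoint $V_{x_0}$--$V_{x_1}$ paths $E_e$ for the edges $e=x_0x_1$ of $X$ such that each $E_e$ is disjoint from every $V_x$ with $x\notin e$ (the branch paths). The model is $K$-fat, for $K\in\mathbb{N}$, if $d_G(Y,Z)\ge K$ for every two distinct $Y,Z\in\mathcal V\cup\mathcal E$ unless one of them is $E_e$ and the other is $V_x$ with $x$ incident to $e$. $X$ is an asymptotic minor of $G$ if for every $K\in\mathbb{N}$ the graph $G$ contains a $K$-fat model of $X$. *)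

theory Defs
  imports "Graph_Theory.Graph_Theory"
begin

text \<open>
  A simple undirected graph, possibly infinite, is a \<^typ>\<open>'a pair_pre_digraph\<close> satisfying
  \<^locale>\<open>pair_bidirected_digraph\<close>: its arc set is an irreflexive symmetric relation on the
  vertex set, and an undirected edge is a pair of opposite arcs.
\<close>

definition graph_edges :: "'a pair_pre_digraph \<Rightarrow> 'a set set" where
  "graph_edges G = (\<lambda>(x, y). {x, y}) ` parcs G"

definition locally_finite :: "'a pair_pre_digraph \<Rightarrow> bool" where
  "locally_finite G \<longleftrightarrow> (\<forall>v\<in>pverts G. finite (out_arcs (with_proj G) v))"

subsection \<open>Paths and distance\<close>

definition path_between :: "'a pair_pre_digraph \<Rightarrow> 'a set \<Rightarrow> 'a list \<Rightarrow> 'a set \<Rightarrow> bool" where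
  "path_between G A p B \<longleftrightarrow>
     vpath p (with_proj G) \<and> set p \<inter> A = {hd p} \<and> set p \<inter> B = {last p}"

definition inner_vertices :: "'a list \<Rightarrow> 'a set" where
  "inner_vertices p = set (butlast (tl p))"

text \<open>The distance is \<open>\<infinity>\<close> between different components, and if one of the sets is empty.\<close>

definition vertex_dist :: "'a pair_pre_digraph \<Rightarrow> 'a \<Rightarrow> 'a \<Rightarrow> enat" where
  "vertex_dist G u v =
     (INF p\<in>{p. vwalk p (with_proj G) \<and> hd p = u \<and> last p = v}. enat (vwalk_length p))"

definition set_dist :: "'a pair_pre_digraph \<Rightarrow> 'a set \<Rightarrow> 'a set \<Rightarrow> enat" where
  "set_dist G A B = (INF a\<in>A. INF b\<in>B. vertex_dist G a b)"

subsection \<open>Ends\<close>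

text \<open>
  A ray, as a subgraph, determines its vertex sequence read from its unique vertex of degree 1,
  so rays are represented by these sequences.
\<close>

definition rays :: "'a pair_pre_digraph \<Rightarrow> (nat \<Rightarrow> 'a) set" where
  "rays G = {r. inj r \<and> range r \<subseteq> pverts G \<and> (\<forall>n. (r n, r (Suc n)) \<in> parcs G)}"

definition ray_equiv :: "'a pair_pre_digraph \<Rightarrow> ((nat \<Rightarrow> 'a) \<times> (nat \<Rightarrow> 'a)) set" where
  "ray_equiv G = {(r, s). r \<in> rays G \<and> s \<in> rays G \<and>
     (\<exists>P. infinite P \<and> (\<forall>p\<in>P. path_between G (range r) p (range s)) \<and>
          pairwise (\<lambda>p q. disjnt (set p) (set q)) P)}"

definition graph_ends :: "'a pair_pre_digraph \<Rightarrow> (nat \<Rightarrow> 'a) set set" where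
  "graph_ends G = rays G // ray_equiv G"

definition one_ended :: "'a pair_pre_digraph \<Rightarrow> bool" where
  "one_ended G \<longleftrightarrow> (\<exists>!\<epsilon>. \<epsilon> \<in> graph_ends G)"

subsection \<open>Fat models and asymptotic minors\<close>

text \<open>
  \<open>V\<close> is indexed by the vertices of \<open>X\<close> and \<open>E\<close> by its undirected edges. As an edge has no
  preferred direction, the vertex list \<open>E {x, y}\<close> may run from \<open>V x\<close> to \<open>V y\<close> or
  from \<open>V y\<close> to \<open>V x\<close>. The library's connectedness includes non-emptiness.
\<close>

definition is_model ::
  "'b pair_pre_digraph \<Rightarrow> 'a pair_pre_digraph \<Rightarrow> ('b \<Rightarrow> 'a set) \<Rightarrow> ('b set \<Rightarrow> 'a list) \<Rightarrow> bool" where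
  "is_model X G V E \<longleftrightarrow>
     (\<forall>x\<in>pverts X. V x \<subseteq> pverts G \<and> Digraph_Component.connected (with_proj G \<restriction> V x)) \<and>
     pairwise (\<lambda>x y. disjnt (V x) (V y)) (pverts X) \<and>
     (\<forall>(x, y)\<in>parcs X.
        path_between G (V x) (E {x, y}) (V y) \<or> path_between G (V y) (E {x, y}) (V x)) \<and>
     pairwise (\<lambda>e f. disjnt (inner_vertices (E e)) (set (E f))) (graph_edges X) \<and>
     (\<forall>e\<in>graph_edges X. \<forall>x\<in>pverts X. x \<notin> e \<longrightarrow> disjnt (set (E e)) (V x))"

definition is_fat_model ::
  "nat \<Rightarrow> 'b pair_pre_digraph \<Rightarrow> 'a pair_pre_digraph \<Rightarrow>
     ('b \<Rightarrow> 'a set) \<Rightarrow> ('b set \<Rightarrow> 'a list) \<Rightarrow> bool" where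
  "is_fat_model K X G V E \<longleftrightarrow>
     is_model X G V E \<and>
     pairwise (\<lambda>x y. enat K \<le> set_dist G (V x) (V y)) (pverts X) \<and>
     pairwise (\<lambda>e f. enat K \<le> set_dist G (set (E e)) (set (E f))) (graph_edges X) \<and>
     (\<forall>e\<in>graph_edges X. \<forall>x\<in>pverts X. x \<notin> e \<longrightarrow> enat K \<le> set_dist G (set (E e)) (V x))"

definition asymptotic_minor :: "'b pair_pre_digraph \<Rightarrow> 'a pair_pre_digraph \<Rightarrow> bool" where
  "asymptotic_minor X G \<longleftrightarrow> (\<forall>K. \<exists>V E. is_fat_model K X G V E)"

subsection \<open>The two graphs\<close>

text \<open>The vertex \<open>(i, n)\<close> is the \<open>n\<close>-th vertex of the \<open>i\<close>-th ray.\<close>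

definition omega_rays :: "(nat \<times> nat) pair_pre_digraph" where
  "omega_rays = \<lparr> pverts = UNIV,
     parcs = {((i, n), (j, m)). i = j \<and> \<bar>int n - int m\<bar> = 1} \<rparr>"

definition half_grid :: "(nat \<times> nat) pair_pre_digraph" where
  "half_grid = \<lparr> pverts = UNIV,
     parcs = {((m, n), (m', n')). \<bar>int m - int m'\<bar> + \<bar>int n - int n'\<bar> = 1} \<rparr>"

lemma pair_bidirected_digraph_omega_rays: "pair_bidirected_digraph omega_rays"
  by unfold_locales (auto simp: omega_rays_def symmetric_def sym_def)

lemma pair_bidirected_digraph_half_grid: "pair_bidirected_digraph half_grid"
  by unfold_locales (auto simp: half_grid_def symmetric_def sym_def)

end

theory Submission
  imports Defs "HOL-Library.Diagonal_Subsequence" "HOL-Library.Ramsey"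
begin

text \<open>
  In a locally finite graph, Koenig's lemma turns a fat model of \<open>\<omega> \<cdot> R\<close> into infinitely many rays
  \<open>R i\<close> that are pairwise far apart (\<open>far_rays_of_fat_omega_rays\<close>). Since the graph has only one end,
  any two of them are joined outside any finite set (\<open>one_ended_rays_joined\<close>). These connections
  may pass close to all other rays, however, and a half-grid needs a sequence of rays in which
  consecutive ones are joined again and again by paths that are far from the others.

  The key step, \<open>chain_of_joined_rays\<close>, shows that a suitable subsequence \<open>x\<close> of the rays has this property:
  \<open>R (x k)\<close> and \<open>R (x (Suc k))\<close> are joined arbitrarily far out by paths that avoid the
  neighbourhoods of any finite number of the other selected rays. The paths may come close to
  rays that are not selected, and this freedom is what makes it work. For each \<open>n\<close> consider the
  graph on the indices up to \<open>n\<close> where \<open>p\<close> and \<open>q\<close> are adjacent if the tails of \<open>R p\<close> and \<open>R q\<close> are joined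
  far out, at distance at least \<open>n\<close> from a base vertex, away from all other rays with index up to \<open>n\<close>.
  This graph is connected (\<open>ray_graph_connected\<close>), so its breadth-first search from \<open>0\<close> orders the
  indices partially, with least element \<open>0\<close>. Along some sequence of values of \<open>n\<close> the orders converge, and
  by Ramsey's theorem some infinite set of indices is an increasing chain, a decreasing chain or
  an antichain in the limit. In a chain, consecutive elements are linked by a monotone walk, which
  meets no further element of the chain. In an antichain, any two elements are linked through \<open>0\<close> by two
  monotone walks, which meet no further element of the antichain.

  The selected rays are the columns of the half-grid (\<open>fat_half_grid\<close>). Branch sets and vertical branch
  paths are consecutive segments of the columns. The horizontal branch paths are chosen one
  after the other, each of them so much further from the base vertex than everything chosen before
  that parts chosen at different times are far apart. What is chosen at the same time is far apart
  because the columns are and because a horizontal path avoids the columns that it does not join.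
\<close>

section \<open>Distances and walks\<close>

text \<open>
  Stating distances through powers of the adjacency relation keeps \<^typ>\<open>enat\<close> and lists of vertices
  out of the combinatorial part.
\<close>

definition far :: "'a rel \<Rightarrow> nat \<Rightarrow> 'a set \<Rightarrow> 'a set \<Rightarrow> bool" where
  "far A K X Y \<longleftrightarrow> (\<forall>x\<in>X. \<forall>y\<in>Y. \<forall>j<K. (x, y) \<notin> A ^^ j)"

lemma sym_relpow: "sym A \<Longrightarrow> (x, y) \<in> A ^^ j \<Longrightarrow> (y, x) \<in> A ^^ j"
proof (induction j arbitrary: x)
  case (Suc j)
  then show ?case by (metis relpow_Suc_E2 relpow_Suc_I symD)
qed auto

lemma far_sym: "sym A \<Longrightarrow> far A K X Y \<Longrightarrow> far A K Y X"
  unfolding far_def using sym_relpow by metis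

lemma far_mono: "far A K X Y \<Longrightarrow> L \<le> K \<Longrightarrow> X' \<subseteq> X \<Longrightarrow> Y' \<subseteq> Y \<Longrightarrow> far A L X' Y'"
  unfolding far_def by (meson less_le_trans subsetD)

lemma far_imp_disjnt: "far A K X Y \<Longrightarrow> 0 < K \<Longrightarrow> disjnt X Y"
  unfolding far_def disjnt_def by force

lemma far_Un:
  "far A K (X \<union> X') Y \<longleftrightarrow> far A K X Y \<and> far A K X' Y"
  "far A K X (Y \<union> Y') \<longleftrightarrow> far A K X Y \<and> far A K X Y'"
  unfolding far_def by blast+

lemma far_UN: "(\<And>n m. far A K (X n) (Y m)) \<Longrightarrow> far A K (\<Union>n. X n) (\<Union>m. Y m)"
  unfolding far_def by blast

lemma sym_rtranclD: "sym A \<Longrightarrow> (x, y) \<in> A\<^sup>* \<Longrightarrow> (y, x) \<in> A\<^sup>*"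
  by (rule symD[OF sym_rtrancl])

lemma vwalk_imp_relpow:
  assumes "vwalk p (with_proj G)"
  shows "(hd p, last p) \<in> parcs G ^^ vwalk_length p"
  using assms
proof (induction p rule: vwalk_induct)
  case (Cons u v es)
  have "(hd (v # es), last (v # es)) \<in> parcs G ^^ length es" using Cons(2) by simp
  then show ?case using relpow_Suc_I2[of u v "parcs G"] Cons(1) by simp
qed auto

lemma relpow_imp_vwalk:
  assumes "pair_wf_digraph G" "(u, v) \<in> parcs G ^^ n" "u \<in> pverts G"
  shows "\<exists>p. vwalk p (with_proj G) \<and> hd p = u \<and> last p = v \<and> vwalk_length p = n"
  using assms(2,3)
proof (induction n arbitrary: u)
  case 0
  then have "vwalk [u] (with_proj G)" by (auto simp: vwalk_def)
  with 0 show ?case by (intro exI[of _ "[u]"]) auto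
next
  case (Suc n)
  then obtain w where w: "(u, w) \<in> parcs G" "(w, v) \<in> parcs G ^^ n" by (meson relpow_Suc_E2)
  then have "w \<in> pverts G" using assms(1) by (auto simp: pair_wf_digraph_def)
  with Suc.IH[OF w(2)] obtain p where
    p: "vwalk p (with_proj G)" "hd p = w" "last p = v" "vwalk_length p = n" by auto
  then have "p \<noteq> []" by auto
  have "vwalk (u # p) (with_proj G)" using p w(1) Suc.prems(2) by (auto intro: vwalk_consI)
  with p \<open>p \<noteq> []\<close> show ?case by (intro exI[of _ "u # p"]) auto
qed

lemma le_set_dist_iff_far:
  assumes "pair_wf_digraph G" "X \<subseteq> pverts G"
  shows "enat K \<le> set_dist G X Y \<longleftrightarrow> far (parcs G) K X Y"
proof -
  have "enat K \<le> vertex_dist G x y \<longleftrightarrow> (\<forall>j<K. (x, y) \<notin> parcs G ^^ j)" if "x \<in> X" for x y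
  proof
    assume *: "enat K \<le> vertex_dist G x y"
    show "\<forall>j<K. (x, y) \<notin> parcs G ^^ j"
    proof (intro allI impI notI)
      fix j assume "j < K" "(x, y) \<in> parcs G ^^ j"
      then obtain p where "vwalk p (with_proj G)" "hd p = x" "last p = y" "vwalk_length p = j"
        using relpow_imp_vwalk[OF assms(1), of x y j] assms(2) \<open>x \<in> X\<close> by blast
      with * \<open>j < K\<close> show False unfolding vertex_dist_def le_INF_iff by fastforce
    qed
  next
    assume *: "\<forall>j<K. (x, y) \<notin> parcs G ^^ j"
    show "enat K \<le> vertex_dist G x y"
      unfolding vertex_dist_def le_INF_iff
    proof clarify
      fix p assume "vwalk p (with_proj G)" "x = hd p" "y = last p"
      with * vwalk_imp_relpow[of p G] have "\<not> vwalk_length p < K" by metis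
      then show "enat K \<le> enat (vwalk_length p)" by simp
    qed
  qed
  then show ?thesis unfolding set_dist_def le_INF_iff far_def by blast
qed

lemma vwalk_connects:
  assumes "vwalk p (with_proj G)"
  shows "(hd p, last p) \<in> (parcs G \<inter> set p \<times> set p)\<^sup>*"
  using assms
proof (induction p rule: vwalk_induct)
  case (Cons u v es)
  have "(v, last (v # es)) \<in> (parcs G \<inter> set (v # es) \<times> set (v # es))\<^sup>*"
    using Cons.IH by (simp only: list.sel)
  then have "(v, last (v # es)) \<in> (parcs G \<inter> set (u # v # es) \<times> set (u # v # es))\<^sup>*"
    by (rule rtrancl_mono[THEN subsetD, rotated]) auto
  moreover have "(u, v) \<in> parcs G \<inter> set (u # v # es) \<times> set (u # v # es)"
    using Cons.hyps by simp
  moreover have "last (u # v # es) = last (v # es)" by simp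
  ultimately show ?case
    unfolding list.sel by (metis converse_rtrancl_into_rtrancl)
qed simp

lemma path_between_ends:
  assumes "path_between G X p Y"
  shows "hd p \<in> set p" "last p \<in> set p" "hd p \<in> X" "last p \<in> Y"
  using assms unfolding path_between_def by blast+

lemma path_between_subset:
  assumes "path_between G X p Y" "X' \<subseteq> X" "Y' \<subseteq> Y" "hd p \<in> X'" "last p \<in> Y'"
  shows "path_between G X' p Y'"
  using assms unfolding path_between_def by blast

lemma path_between_verts: "path_between G X p Y \<Longrightarrow> set p \<subseteq> pverts G"
  by (simp add: path_between_def vpath_def vwalk_def)

text \<open>
  Among all walks inside \<open>r\<close> that lead from \<open>X\<close> to \<open>Y\<close> a shortest one is a path: cutting out a cycle,
  or the part before a later visit of \<open>X\<close> or after an earlier visit of \<open>Y\<close>, would shorten it.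
\<close>

lemma shortest_path_between:
  assumes "(a, b) \<in> r\<^sup>*" "a \<in> X" "b \<in> Y" "r \<subseteq> parcs G \<inter> U \<times> U" "a \<in> U" "U \<subseteq> pverts G"
  shows "\<exists>p. path_between G X p Y \<and> set p \<subseteq> U"
proof -
  let ?W = "\<lambda>p. p \<noteq> [] \<and> set (vwalk_arcs p) \<subseteq> r \<and> set p \<subseteq> U \<and> hd p \<in> X \<and> last p \<in> Y"
  have "\<exists>p. p \<noteq> [] \<and> set (vwalk_arcs p) \<subseteq> r \<and> set p \<subseteq> U \<and> hd p = a \<and> last p = b"
    using assms(1)
  proof (induction rule: rtrancl_induct)
    case base
    then show ?case using assms(5) by (intro exI[of _ "[a]"]) auto
  next
    case (step y z)
    then obtain p where p: "p \<noteq> []" "set (vwalk_arcs p) \<subseteq> r" "set p \<subseteq> U" "hd p = a" "last p = y"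
      by blast
    then show ?case using step assms(4)
      by (intro exI[of _ "p @ [z]"]) (auto simp: vwalk_arcs_append)
  qed
  then have "\<exists>p. ?W p" using assms(2,3) by metis
  then obtain q where "?W q" ..
  then obtain p where p: "?W p" and "\<forall>q. ?W q \<longrightarrow> length p \<le> length q"
    using arg_min_nat_lemma[of ?W q length] by blast
  then have min: "\<And>q. ?W q \<Longrightarrow> length p \<le> length q" by blast
  have arcs_sub: "set (vwalk_arcs (xs @ zs)) \<subseteq> set (vwalk_arcs (xs @ ys @ zs))"
    if "xs = [] \<or> zs = [] \<or> last xs = last ys \<and> ys \<noteq> []" for xs ys zs :: "'a list"
    using that by (cases "xs = []"; cases "ys = []"; cases "zs = []") (auto simp: vwalk_arcs_append)
  have X: "set p \<inter> X = {hd p}"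
  proof -
    have "x = hd p" if "x \<in> set p" "x \<in> X" for x
    proof -
      obtain ys zs where ps: "p = ys @ x # zs" using \<open>x \<in> set p\<close> by (meson split_list)
      have "?W (x # zs)" using p \<open>x \<in> X\<close> arcs_sub[of "[]" "x # zs" ys] unfolding ps by auto
      from min[OF this] show ?thesis by (simp add: ps)
    qed
    then show ?thesis using p by auto
  qed
  have Y: "set p \<inter> Y = {last p}"
  proof -
    have "x = last p" if "x \<in> set p" "x \<in> Y" for x
    proof -
      obtain ys zs where ps: "p = ys @ x # zs" using \<open>x \<in> set p\<close> by (meson split_list)
      have "?W (ys @ [x])" using p \<open>x \<in> Y\<close> arcs_sub[of "ys @ [x]" "[]" zs] unfolding ps
        by (auto simp: hd_append split: if_splits)
      from min[OF this] show ?thesis by (simp add: ps)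
    qed
    then show ?thesis using p by auto
  qed
  have "distinct p"
  proof (rule ccontr)
    assume "\<not> distinct p"
    then obtain xs y ys zs where ps: "p = xs @ [y] @ ys @ [y] @ zs"
      using not_distinct_decomp by blast
    have "?W ((xs @ [y]) @ zs)" using p arcs_sub[of "xs @ [y]" zs "ys @ [y]"]
      unfolding ps by (auto simp: hd_append split: if_splits)
    from min[OF this] show False by (simp add: ps)
  qed
  then have "path_between G X p Y"
    using p X Y assms(4,6) by (auto simp: path_between_def vpath_def vwalk_def)
  with p show ?thesis by blast
qed

lemma map_ray_vpath:
  assumes "inj r" "\<And>n. (r n, r (Suc n)) \<in> parcs G" "range r \<subseteq> pverts G" "i \<le> j"
  shows "vpath (map r [i..<Suc j]) (with_proj G)"
proof -
  have "set (vwalk_arcs (map r [i..<Suc (i + k)])) \<subseteq> parcs G" for k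
  proof (induction k)
    case (Suc k)
    have "map r [i..<Suc (i + Suc k)] = map r [i..<Suc (i + k)] @ [r (i + Suc k)]" by simp
    moreover have "last (map r [i..<Suc (i + k)]) = r (i + k)" by simp
    moreover have "(r (i + k), r (i + Suc k)) \<in> parcs G" using assms(2)[of "i + k"] by simp
    ultimately show ?case using Suc vwalk_arcs_append[of "map r [i..<Suc (i + k)]" "[r (i + Suc k)]"]
      by (simp del: upt_Suc)
  qed simp
  from this[of "j - i"] show ?thesis
    using assms by (auto simp: vpath_def vwalk_def distinct_map inj_on_def simp del: upt_Suc)
qed

lemma sym_parcs: "pair_sym_digraph G \<Longrightarrow> sym (parcs G)"
  by (simp add: pair_sym_digraph_def pair_sym_digraph_axioms_def symmetric_def)

text \<open>
  Connectedness in the library means mutual reachability in the symmetric closure of the induced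
  subgraph; for symmetric \<open>G\<close> this is reachability along the arcs within \<open>X\<close>.
\<close>

lemma connected_induced_iff:
  assumes "pair_sym_digraph G" "X \<subseteq> pverts G"
  shows "Digraph_Component.connected (with_proj G \<restriction> X) \<longleftrightarrow>
    X \<noteq> {} \<and> (\<forall>u\<in>X. \<forall>v\<in>X. (u, v) \<in> (parcs G \<inter> X \<times> X)\<^sup>*)"
proof -
  let ?H = "mk_symmetric (with_proj G \<restriction> X)"
  have arcs: "parcs ?H = parcs G \<inter> X \<times> X"
    using symD[OF sym_parcs[OF assms(1)]] by (auto simp: parcs_mk_symmetric induce_subgraph_def)
  have verts: "pverts ?H = X" by (simp add: induce_subgraph_def)
  have reach: "(u, v) \<in> rtrancl_on X (parcs G \<inter> X \<times> X) \<longleftrightarrow> (u, v) \<in> (parcs G \<inter> X \<times> X)\<^sup>*"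
    if "u \<in> X" "v \<in> X" for u v
  proof
    show "(u, v) \<in> rtrancl_on X (parcs G \<inter> X \<times> X)" if "(u, v) \<in> (parcs G \<inter> X \<times> X)\<^sup>*"
      using that \<open>v \<in> X\<close>
    proof (induction rule: converse_rtrancl_induct)
      case base
      then show ?case by (rule rtrancl_on_refl)
    next
      case (step y z)
      then show ?case by (intro converse_rtrancl_on_into_rtrancl_on[of y z]) auto
    qed
  qed (rule rtrancl_on_rtranclI)
  have "Digraph_Component.connected (with_proj G \<restriction> X) \<longleftrightarrow>
    X \<noteq> {} \<and> (\<forall>u\<in>X. \<forall>v\<in>X. (u, v) \<in> rtrancl_on X (parcs G \<inter> X \<times> X))"
    unfolding Digraph_Component.connected_def strongly_connected_def reachable_def
      with_proj_simps arcs verts by blast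
  also have "\<dots> \<longleftrightarrow> X \<noteq> {} \<and> (\<forall>u\<in>X. \<forall>v\<in>X. (u, v) \<in> (parcs G \<inter> X \<times> X)\<^sup>*)"
    using reach by blast
  finally show ?thesis .
qed

lemma locally_finite_image:
  assumes "pair_bidirected_digraph G" "locally_finite G"
  shows "finite (parcs G `` {v})"
proof (cases "v \<in> pverts G")
  case True
  then have "finite (snd ` out_arcs (with_proj G) v)" using assms(2) by (simp add: locally_finite_def)
  moreover have "parcs G `` {v} \<subseteq> snd ` out_arcs (with_proj G) v"
    unfolding out_arcs_def by force
  ultimately show ?thesis by (rule finite_subset[rotated])
next
  case False
  then have "parcs G `` {v} = {}"
    using assms(1) by (auto simp: pair_bidirected_digraph_def pair_sym_digraph_def pair_wf_digraph_def)
  then show ?thesis by simp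
qed

lemma is_fat_model_mono: "is_fat_model L X G V E \<Longrightarrow> K \<le> L \<Longrightarrow> is_fat_model K X G V E"
  unfolding is_fat_model_def pairwise_def using order_trans[of "enat K" "enat L"] by simp

section \<open>Breadth-first search\<close>

definition level :: "'a rel \<Rightarrow> 'a \<Rightarrow> 'a \<Rightarrow> nat" where
  "level B r v = (LEAST n. (r, v) \<in> B ^^ n)"

definition bfs :: "'a rel \<Rightarrow> 'a \<Rightarrow> 'a rel" where
  "bfs B r = {(u, v) \<in> B. level B r v = Suc (level B r u)}"

lemma level_in: "(r, v) \<in> B\<^sup>* \<Longrightarrow> (r, v) \<in> B ^^ level B r v"
  unfolding level_def by (metis LeastI rtrancl_imp_relpow)

lemma level_le: "(r, v) \<in> B ^^ n \<Longrightarrow> level B r v \<le> n"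
  unfolding level_def by (rule Least_le)

lemma level_triangle:
  assumes "(r, u) \<in> B\<^sup>*" "(u, v) \<in> B ^^ k"
  shows "level B r v \<le> level B r u + k"
  using level_in[OF assms(1)] assms(2) by (intro level_le) (auto simp: relpow_add)

lemma level_root [simp]: "level B r r = 0"
  using level_le[of r r 0 B] by simp

text \<open>
  The arcs of a shortest walk from the root each go up by one level.
\<close>

lemma bfs_reaches:
  assumes "(r, v) \<in> B\<^sup>*"
  shows "(r, v) \<in> (bfs B r)\<^sup>*"
  using assms
proof (induction "level B r v" arbitrary: v)
  case 0
  then show ?case using level_in[of r v B] by simp
next
  case (Suc n)
  have "(r, v) \<in> B ^^ Suc n" using level_in[OF Suc.prems] Suc.hyps(2) by simp
  then obtain u where u: "(r, u) \<in> B ^^ n" "(u, v) \<in> B" by auto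
  have ru: "(r, u) \<in> B\<^sup>*" using u(1) by (rule relpow_imp_rtrancl)
  have "level B r u = n"
    using level_le[OF u(1)] level_triangle[OF ru, of v 1] u(2) Suc.hyps(2) by simp
  then have "(u, v) \<in> bfs B r" "(r, u) \<in> (bfs B r)\<^sup>*"
    using u(2) Suc.hyps ru by (auto simp: bfs_def)
  then show ?case by simp
qed

lemma bfs_rtrancl_level:
  "(u, v) \<in> (bfs B r)\<^sup>* \<Longrightarrow> u = v \<or> level B r u < level B r v"
  by (induction rule: rtrancl_induct) (auto simp: bfs_def)

lemma bfs_antisym: "(u, v) \<in> (bfs B r)\<^sup>* \<Longrightarrow> (v, u) \<in> (bfs B r)\<^sup>* \<Longrightarrow> u = v"
  by (blast dest: bfs_rtrancl_level less_asym)

text \<open>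
  A ray grows along the arcs of \<^const>\<open>bfs\<close>: if infinitely many vertices lie above \<open>u\<close>, then, as
  \<open>u\<close> has finitely many successors, infinitely many lie above one of them. The ray is injective
  because its \<open>n\<close>-th vertex has level \<open>n\<close>.
\<close>

lemma koenig:
  assumes fin: "\<And>v. finite (B `` {v})" and inf: "infinite {v. (r, v) \<in> B\<^sup>*}"
  shows "\<exists>f. f 0 = r \<and> inj f \<and> (\<forall>n. (f n, f (Suc n)) \<in> B)"
proof -
  let ?D = "bfs B r"
  let ?big = "\<lambda>u. infinite (?D\<^sup>* `` {u})"
  have "?D\<^sup>* `` {r} \<supseteq> {v. (r, v) \<in> B\<^sup>*}" using bfs_reaches by fast
  then have big_r: "?big r" using inf infinite_super by blast
  have step: "\<exists>v. (u, v) \<in> ?D \<and> ?big v" if "?big u" for u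
  proof (rule ccontr)
    assume no: "\<not> ?thesis"
    have "finite (?D `` {u})" by (rule finite_subset[OF _ fin[of u]]) (auto simp: bfs_def)
    moreover have "?D\<^sup>* `` {u} \<subseteq> insert u (\<Union>v\<in>?D `` {u}. ?D\<^sup>* `` {v})"
      by (auto elim: converse_rtranclE)
    ultimately show False using no that by (auto dest: finite_subset)
  qed
  obtain f where f: "f 0 = r" "\<And>n. ?big (f n)" "\<And>n. (f n, f (Suc n)) \<in> ?D"
    using dependent_nat_choice[of "\<lambda>n u. ?big u \<and> (n = 0 \<longrightarrow> u = r)" "\<lambda>n u v. (u, v) \<in> ?D"]
      big_r step by (metis nat.distinct(1))
  have "level B r (f n) = n" for n
    using f by (induction n) (auto simp: bfs_def)
  then have "inj f" by (metis injI)
  with f show ?thesis by (auto simp: bfs_def)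
qed

lemma rtrancl_between:
  assumes "(a, b) \<in> D\<^sup>*" "\<And>w. (a, w) \<in> D\<^sup>* \<Longrightarrow> (w, b) \<in> D\<^sup>* \<Longrightarrow> w \<in> S"
  shows "(a, b) \<in> (D \<inter> S \<times> S)\<^sup>*"
  using assms
proof (induction rule: rtrancl_induct)
  case (step b c)
  have "w \<in> S" if "(a, w) \<in> D\<^sup>*" "(w, b) \<in> D\<^sup>*" for w
    using step.prems[OF that(1) rtrancl_into_rtrancl[OF that(2) step.hyps(2)]] .
  then have "(a, b) \<in> (D \<inter> S \<times> S)\<^sup>*" by (rule step.IH)
  moreover have "b \<in> S" using step.prems[OF step.hyps(1) r_into_rtrancl[OF step.hyps(2)]] .
  moreover have "c \<in> S"
    using step.prems[OF rtrancl_into_rtrancl[OF step.hyps(1,2)] rtrancl_refl] .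
  ultimately show ?case using step.hyps(2) by (auto intro: rtrancl_into_rtrancl)
qed simp

section \<open>Convergent and homogeneous subsequences\<close>

text \<open>
  Bolzano-Weierstrass for sequences of subsets of \<^typ>\<open>nat\<close>: a diagonal subsequence decides every
  number eventually.
\<close>

lemma diagonal_convergence:
  fixes Q :: "nat \<Rightarrow> nat \<Rightarrow> bool"
  shows "\<exists>(s :: nat \<Rightarrow> nat) L. strict_mono s \<and> (\<forall>k. \<exists>n0. \<forall>n\<ge>n0. Q k (s n) = L k)"
proof -
  define P where "P k s \<longleftrightarrow> (\<exists>l. \<forall>n. Q k (s n) = l)" for k and s :: "nat \<Rightarrow> nat"
  interpret subseqs P
  proof
    fix k and s :: "nat \<Rightarrow> nat"
    have "\<exists>l. infinite {n. Q k (s n) = l}"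
    proof (rule ccontr)
      assume "\<not> ?thesis"
      then have "finite {n. Q k (s n) = l}" for l by simp
      from this[of True] this[of False] have "finite ({n. Q k (s n)} \<union> {n. \<not> Q k (s n)})" by simp
      moreover have "{n. Q k (s n)} \<union> {n. \<not> Q k (s n)} = UNIV" by auto
      ultimately show False by simp
    qed
    then obtain l where "infinite {n. Q k (s n) = l}" ..
    then have "strict_mono (enumerate {n. Q k (s n) = l})"
      and "\<And>n. enumerate {n. Q k (s n) = l} n \<in> {n. Q k (s n) = l}"
      by (rule strict_mono_enumerate, rule enumerate_in_set)
    then show "\<exists>r. strict_mono r \<and> P k (s \<circ> r)"
      unfolding P_def o_def mem_Collect_eq by (intro exI conjI allI)
  qed
  have "\<exists>l. \<forall>n. Q k (diagseq (Suc k + n)) = l" for k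
  proof -
    have "P k (diagseq \<circ> (+) (Suc k))"
    proof (rule diagseq_holds)
      fix r s :: "nat \<Rightarrow> nat" and n assume "P n s"
      then obtain l where "\<forall>i. Q n (s i) = l" unfolding P_def ..
      then show "P n (s \<circ> r)" unfolding P_def o_def by (intro exI[of _ l]) simp
    qed
    then show ?thesis by (simp only: P_def o_def)
  qed
  then obtain L where L: "\<And>k n. Q k (diagseq (Suc k + n)) = L k" by metis
  have "\<forall>n\<ge>Suc k. Q k (diagseq n) = L k" for k
  proof (intro allI impI)
    fix n assume "Suc k \<le> n"
    then show "Q k (diagseq n) = L k" using L[of k "n - Suc k"] by simp
  qed
  then have "\<exists>n0. \<forall>n\<ge>n0. Q k (diagseq n) = L k" for k by (rule exI)
  then show ?thesis
    using subseq_diagseq by (intro exI[of _ diagseq] exI[of _ L] conjI allI)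
qed

text \<open>
  Ramsey's theorem for pairs \<open>i < j\<close>, coloured by whether \<open>anc i j\<close> holds, else by whether
  \<open>anc j i\<close> holds. For a partial order the three outcomes are an increasing chain, a decreasing
  chain and an antichain.
\<close>

lemma homogeneous_subsequence:
  fixes anc :: "nat \<Rightarrow> nat \<Rightarrow> bool"
  obtains x :: "nat \<Rightarrow> nat" where "strict_mono x"
    "(\<forall>i j. i < j \<longrightarrow> anc (x i) (x j)) \<or> (\<forall>i j. i < j \<longrightarrow> anc (x j) (x i)) \<or>
     (\<forall>i j. i \<noteq> j \<longrightarrow> \<not> anc (x i) (x j))"
proof -
  define f where "f S = (if anc (Min S) (Max S) then 0 else if anc (Max S) (Min S) then 1 else 2 :: nat)" for S
  have "\<forall>x\<in>UNIV. \<forall>y\<in>UNIV. x \<noteq> y \<longrightarrow> f {x, y} < 3" by (simp add: f_def)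
  from Ramsey2[OF infinite_UNIV_nat this] obtain Y t where Y: "infinite Y" and "t < 3"
    and t: "\<forall>x\<in>Y. \<forall>y\<in>Y. x \<noteq> y \<longrightarrow> f {x, y} = t" by (elim exE conjE)
  define x where "x = enumerate Y"
  have mono: "strict_mono x" unfolding x_def using Y by (rule strict_mono_enumerate)
  have col: "(if anc (x i) (x j) then 0 else if anc (x j) (x i) then 1 else 2) = t" if "i < j" for i j
  proof -
    have "x i < x j" using mono that by (rule strict_monoD)
    moreover have "x i \<in> Y" "x j \<in> Y" unfolding x_def using Y by (simp_all add: enumerate_in_set)
    ultimately have "f {x i, x j} = t" using t by (simp add: less_imp_neq)
    moreover have "Min {x i, x j} = x i" "Max {x i, x j} = x j" using \<open>x i < x j\<close> by simp_all
    ultimately show ?thesis unfolding f_def by (simp only:)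
  qed
  from \<open>t < 3\<close> consider "t = 0" | "t = 1" | "t = 2" by linarith
  then have "(\<forall>i j. i < j \<longrightarrow> anc (x i) (x j)) \<or> (\<forall>i j. i < j \<longrightarrow> anc (x j) (x i)) \<or>
     (\<forall>i j. i \<noteq> j \<longrightarrow> \<not> anc (x i) (x j))"
  proof cases
    case 1
    then have "anc (x i) (x j)" if "i < j" for i j
      using col[OF that] by (cases "anc (x i) (x j)"; cases "anc (x j) (x i)") simp_all
    then show ?thesis by simp
  next
    case 2
    then have "anc (x j) (x i)" if "i < j" for i j
      using col[OF that] by (cases "anc (x i) (x j)"; cases "anc (x j) (x i)") simp_all
    then show ?thesis by simp
  next
    case 3
    then have "\<not> anc (x i) (x j) \<and> \<not> anc (x j) (x i)" if "i < j" for i j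
      using col[OF that] by (cases "anc (x i) (x j)"; cases "anc (x j) (x i)") simp_all
    then show ?thesis by (simp add: nat_neq_iff)
  qed
  with mono show ?thesis by (rule that)
qed

section \<open>Joining rays away from the others\<close>

text \<open>
  What remains of the hypotheses once the rays have been extracted. The distance \<open>2 * K + 1\<close> makes the
  \<open>K\<close>-neighbourhoods of the rays disjoint.
\<close>

locale ray_family =
  fixes A :: "'a rel" and R :: "nat \<Rightarrow> nat \<Rightarrow> 'a" and K :: nat
  assumes sym: "sym A"
    and fin: "\<And>v. finite (A `` {v})"
    and ray_inj: "\<And>i. inj (R i)"
    and ray_step: "\<And>i n. (R i n, R i (Suc n)) \<in> A"
    and rays_far: "\<And>i j. i \<noteq> j \<Longrightarrow> far A (2 * K + 1) (range (R i)) (range (R j))"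
    and rays_joined: "\<And>i j X. finite X \<Longrightarrow>
      \<exists>a\<in>range (R i). \<exists>b\<in>range (R j). a \<notin> X \<and> (a, b) \<in> (A \<inter> (- X) \<times> (- X))\<^sup>*"
begin

abbreviation height :: "'a \<Rightarrow> nat" where "height \<equiv> level A (R 0 0)"

definition component :: "'a set" where "component = A\<^sup>* `` {R 0 0}"

definition nbhd :: "nat \<Rightarrow> 'a set" where
  "nbhd i = {v. \<exists>j\<le>K. \<exists>a\<in>range (R i). (a, v) \<in> A ^^ j}"

text \<open>
  The restriction to one component makes the set of vertices of bounded height finite.
\<close>

definition region :: "nat \<Rightarrow> nat set \<Rightarrow> 'a set" where
  "region n W = {v \<in> component. n \<le> height v \<and> (\<forall>w\<in>W. v \<notin> nbhd w)}"

definition conn :: "nat \<Rightarrow> nat set \<Rightarrow> 'a rel" where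
  "conn n W = (A \<inter> region n W \<times> region n W)\<^sup>*"

lemma conn_mono: "n' \<le> n \<Longrightarrow> W' \<subseteq> W \<Longrightarrow> conn n W \<subseteq> conn n' W'"
  unfolding conn_def by (intro rtrancl_mono) (auto simp: region_def)

lemma conn_step: "u \<in> region n W \<Longrightarrow> v \<in> region n W \<Longrightarrow> (u, v) \<in> A \<Longrightarrow> (u, v) \<in> conn n W"
  unfolding conn_def by (rule r_into_rtrancl) blast

lemma conn_refl: "(u, u) \<in> conn n W"
  unfolding conn_def by simp

lemma conn_trans: "(u, v) \<in> conn n W \<Longrightarrow> (v, w) \<in> conn n W \<Longrightarrow> (u, w) \<in> conn n W"
  unfolding conn_def by (rule rtrancl_trans)

lemma conn_sym: "(u, v) \<in> conn n W \<Longrightarrow> (v, u) \<in> conn n W"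
  unfolding conn_def using sym by (elim sym_rtranclD[rotated]) (auto simp: sym_def)

lemma component_step: "u \<in> component \<Longrightarrow> (u, v) \<in> A \<Longrightarrow> v \<in> component"
  unfolding component_def by (auto intro: rtrancl_into_rtrancl)

lemma ray_rtrancl: "(R i m, R i n) \<in> A\<^sup>*"
proof -
  have "(R i 0, R i n) \<in> A\<^sup>*" for n
    by (induction n) (auto intro: rtrancl_into_rtrancl ray_step)
  then show ?thesis using rtrancl_trans[OF sym_rtranclD[OF sym]] by metis
qed

lemma ray_in_component: "R i n \<in> component"
proof -
  obtain a b where ab: "a \<in> range (R 0)" "b \<in> range (R i)"
    and "(a, b) \<in> (A \<inter> (- {}) \<times> (- {}))\<^sup>*" using rays_joined[of "{}" 0 i] by blast
  then have "(a, b) \<in> A\<^sup>*" by simp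
  moreover from ab have "(R 0 0, a) \<in> A\<^sup>*" "(b, R i n) \<in> A\<^sup>*" using ray_rtrancl by auto
  ultimately have "(R 0 0, R i n) \<in> A\<^sup>*" by (meson rtrancl_trans)
  then show ?thesis by (simp add: component_def)
qed

lemma height_step: "u \<in> component \<Longrightarrow> (u, v) \<in> A ^^ k \<Longrightarrow> height v \<le> height u + k"
  unfolding component_def by (auto intro: level_triangle)

lemma finite_low: "finite {v \<in> component. height v < n}"
proof -
  have "finite ((A ^^ k) `` {R 0 0})" for k
  proof (induction k)
    case (Suc k)
    have "(A ^^ Suc k) `` {R 0 0} = (\<Union>u\<in>(A ^^ k) `` {R 0 0}. A `` {u})" by auto
    with Suc fin show ?case by simp
  qed simp
  moreover have "{v \<in> component. height v < n} \<subseteq> (\<Union>k<n. (A ^^ k) `` {R 0 0})"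
    unfolding component_def using level_in by fast
  ultimately show ?thesis by (meson finite_UN finite_lessThan finite_subset)
qed

lemma ray_eventually_high: "\<exists>M. \<forall>i\<ge>M. n \<le> height (R p i)"
proof -
  have "finite (R p -` {v \<in> component. height v < n})"
    by (intro finite_vimageI finite_low ray_inj)
  then obtain M where "\<And>i. i \<in> R p -` {v \<in> component. height v < n} \<Longrightarrow> i < M"
    by (metis finite_nat_set_iff_bounded)
  then show ?thesis using ray_in_component by (intro exI[of _ M]) (force simp: not_less[symmetric])
qed

text \<open>
  A ray may return to low height many times; from this index on it stays at height at least \<open>n\<close>.
\<close>

definition tail_start :: "nat \<Rightarrow> nat \<Rightarrow> nat" where
  "tail_start n p = (SOME M. \<forall>i\<ge>M. n \<le> height (R p i))"

lemma tail_high: "tail_start n p \<le> i \<Longrightarrow> n \<le> height (R p i)"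
  using someI_ex[OF ray_eventually_high[of n p]] unfolding tail_start_def by blast

lemma nbhdI: "a \<in> range (R i) \<Longrightarrow> (a, v) \<in> A ^^ j \<Longrightarrow> j \<le> K \<Longrightarrow> v \<in> nbhd i"
  unfolding nbhd_def by blast

lemma ray_in_nbhd: "R i n \<in> nbhd i"
  by (rule nbhdI[of _ _ _ 0]) auto

lemma nbhd_unique:
  assumes "v \<in> nbhd i" "v \<in> nbhd j"
  shows "i = j"
proof (rule ccontr)
  assume "i \<noteq> j"
  obtain k a where a: "k \<le> K" "a \<in> range (R i)" "(a, v) \<in> A ^^ k"
    using assms(1) unfolding nbhd_def by blast
  obtain l b where b: "l \<le> K" "b \<in> range (R j)" "(b, v) \<in> A ^^ l"
    using assms(2) unfolding nbhd_def by blast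
  have "(a, b) \<in> A ^^ (k + l)" using a(3) sym_relpow[OF sym b(3)] by (auto simp: relpow_add)
  then show False using rays_far[OF \<open>i \<noteq> j\<close>] a b unfolding far_def by force
qed

lemma tail_in_region: "p \<notin> W \<Longrightarrow> tail_start n p \<le> i \<Longrightarrow> R p i \<in> region n W"
  using ray_in_component tail_high nbhd_unique[OF ray_in_nbhd] unfolding region_def by blast

lemma tail_conn:
  assumes "p \<notin> W" "tail_start n p \<le> i" "tail_start n p \<le> j"
  shows "(R p i, R p j) \<in> conn n W"
proof -
  have "(R p (tail_start n p), R p (tail_start n p + k)) \<in> conn n W" for k
  proof (induction k)
    case (Suc k)
    moreover have "(R p (tail_start n p + k), R p (tail_start n p + Suc k)) \<in> conn n W"
      using ray_step[of p "tail_start n p + k"] assms(1)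
      by (intro conn_step tail_in_region) auto
    ultimately show ?case by (rule conn_trans)
  qed (simp add: conn_refl)
  from this[of "i - tail_start n p"] this[of "j - tail_start n p"] assms(2,3)
  show ?thesis by (auto intro: conn_trans conn_sym)
qed

text \<open>
  A connection may approach rays with index beyond \<open>n\<close>. Only finitely many rays are avoided at a time
  because only for finitely many a common height bounds the parts before their tails.
\<close>

definition ray_graph :: "nat \<Rightarrow> nat rel" where
  "ray_graph n = {(p, q). p \<le> n \<and> q \<le> n \<and>
     (\<exists>i\<ge>tail_start n p. \<exists>j\<ge>tail_start n q. (R p i, R q j) \<in> conn n ({..n} - {p, q}))}"

lemma sym_ray_graph: "sym (ray_graph n)"
  unfolding ray_graph_def by (rule symI) (auto simp: insert_commute dest: conn_sym)

text \<open>
  A vertex near the ray \<open>R w\<close> that is high enough is near its tail, and the short walk to the tail loses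
  at most \<open>K\<close> of height and stays within the neighbourhood of \<open>R w\<close>, hence away from all other rays.
\<close>

lemma nbhd_to_tail:
  assumes low: "\<And>i. i < tail_start n w \<Longrightarrow> height (R w i) < M" and "n \<le> M"
  shows "(a, v) \<in> A ^^ j \<Longrightarrow> a \<in> range (R w) \<Longrightarrow> j \<le> K \<Longrightarrow> v \<in> component \<Longrightarrow> M + j \<le> height v \<Longrightarrow>
    \<exists>i\<ge>tail_start n w. (R w i, v) \<in> conn n ({..n} - {w})"
proof (induction j arbitrary: v)
  case 0
  then obtain i where "v = R w i" by auto
  with 0 low[of i] show ?case by (intro exI[of _ i]) (auto simp: conn_refl not_less[symmetric])
next
  case (Suc j)
  then obtain u where u: "(a, u) \<in> A ^^ j" "(u, v) \<in> A" by auto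
  have "(v, u) \<in> A" using u(2) sym by (rule symD[rotated])
  then have "u \<in> component" using Suc.prems(4) component_step by blast
  moreover have "height v \<le> height u + 1" using height_step[OF \<open>u \<in> component\<close>, of v 1] u(2) by simp
  ultimately obtain i where i: "i \<ge> tail_start n w" "(R w i, u) \<in> conn n ({..n} - {w})"
    using Suc.IH[OF u(1)] Suc.prems by auto
  have "u \<in> nbhd w" "v \<in> nbhd w"
    using u(1) Suc.prems(1-3) nbhdI[of _ w] Suc_leD by blast+
  then have "u \<in> region n ({..n} - {w})" "v \<in> region n ({..n} - {w})"
    using \<open>u \<in> component\<close> Suc.prems(4,5) \<open>height v \<le> height u + 1\<close> \<open>n \<le> M\<close> nbhd_unique
    unfolding region_def by auto
  then show ?case using i u(2) conn_step conn_trans by blast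
qed

text \<open>
  Walk from \<open>R 0\<close> to \<open>R q\<close> so high up that only tails can be near the walk, and record the ray whose
  neighbourhood was visited last. When the walk enters the neighbourhood of a new ray, the piece
  since it was close to the recorded one keeps away from all others, so it yields an edge.
\<close>

lemma ray_graph_connected:
  assumes "q \<le> n"
  shows "(0, q) \<in> (ray_graph n)\<^sup>*"
proof -
  have "finite ((\<lambda>(p, i). height (R p i)) ` (SIGMA p:{..n}. {..<tail_start n p}))" by simp
  then obtain M0 where "\<And>h. h \<in> (\<lambda>(p, i). height (R p i)) ` (SIGMA p:{..n}. {..<tail_start n p}) \<Longrightarrow> h < M0"
    by (metis finite_nat_set_iff_bounded)
  then have M0: "\<And>p i. p \<le> n \<Longrightarrow> i < tail_start n p \<Longrightarrow> height (R p i) < M0" by force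
  define M where "M = M0 + n"
  have low: "\<And>p i. p \<le> n \<Longrightarrow> i < tail_start n p \<Longrightarrow> height (R p i) < M" and "n \<le> M"
    using M0 by (auto simp: M_def intro: trans_less_add1)
  \<comment> \<open>\<open>M\<close> exceeds the heights of the initial parts; the margin \<open>K\<close> is what short walks to a ray may lose.\<close>
  define X where "X = {v \<in> component. height v < M + K}"
  obtain a b where ab: "a \<in> range (R 0)" "b \<in> range (R q)" "a \<notin> X"
    "(a, b) \<in> (A \<inter> (- X) \<times> (- X))\<^sup>*"
    using rays_joined[of X 0 q] finite_low unfolding X_def by blast
  let ?B = "A \<inter> (- X) \<times> (- X)"
  have inv: "v \<in> component \<and> M + K \<le> height v \<and>
     (\<exists>p\<le>n. (0, p) \<in> (ray_graph n)\<^sup>* \<and> (\<forall>w\<le>n. v \<in> nbhd w \<longrightarrow> w = p) \<and>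
        (\<exists>i\<ge>tail_start n p. (R p i, v) \<in> conn n ({..n} - {p})))"
    if "(a, v) \<in> ?B\<^sup>*" for v
    using that
  proof (induction rule: rtrancl_induct)
    case base
    obtain i where i: "a = R 0 i" using ab(1) by auto
    have a: "a \<in> component" "M + K \<le> height a" using ab(3) ray_in_component i unfolding X_def by auto
    then have "tail_start n 0 \<le> i" using low[of 0 i] i by (cases "i < tail_start n 0") auto
    moreover have "\<forall>w\<le>n. a \<in> nbhd w \<longrightarrow> w = 0" using nbhd_unique ray_in_nbhd i by blast
    ultimately have "\<exists>j\<ge>tail_start n 0. (R 0 j, a) \<in> conn n ({..n} - {0})"
      "\<forall>w\<le>n. a \<in> nbhd w \<longrightarrow> w = 0"
      using i conn_refl by blast+
    then show ?case using a by blast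
  next
    case (step v v')
    then obtain p i where p: "p \<le> n" "(0, p) \<in> (ray_graph n)\<^sup>*" "\<And>w. w \<le> n \<Longrightarrow> v \<in> nbhd w \<Longrightarrow> w = p"
      and i: "i \<ge> tail_start n p" "(R p i, v) \<in> conn n ({..n} - {p})" and v: "v \<in> component" "M + K \<le> height v"
      by blast
    have v': "v' \<in> component" "M + K \<le> height v'" and vv': "(v, v') \<in> A"
      using step.hyps(2) v(1) component_step unfolding X_def by auto
    show ?case
    proof (cases "\<exists>w\<le>n. v' \<in> nbhd w \<and> w \<noteq> p")
      case True
      then obtain w where w: "w \<le> n" "v' \<in> nbhd w" "w \<noteq> p" by blast
      then obtain k c where c: "k \<le> K" "c \<in> range (R w)" "(c, v') \<in> A ^^ k"
        unfolding nbhd_def by blast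
      obtain j where j: "j \<ge> tail_start n w" "(R w j, v') \<in> conn n ({..n} - {w})"
        using nbhd_to_tail[OF low[OF w(1)] \<open>n \<le> M\<close> c(3,2,1) v'(1)] v'(2) c(1) by auto
      let ?W = "{..n} - {p, w}"
      have "(R p i, v) \<in> conn n ?W" "(v', R w j) \<in> conn n ?W"
        using i(2) j(2) conn_mono[of n n ?W] conn_sym by blast+
      moreover have "(v, v') \<in> conn n ?W"
        using v v' p(3) nbhd_unique[OF w(2)] \<open>n \<le> M\<close> vv'
        by (intro conn_step) (auto simp: region_def)
      ultimately have "(R p i, R w j) \<in> conn n ?W" by (blast intro: conn_trans)
      then have "(p, w) \<in> ray_graph n" unfolding ray_graph_def using p(1) w(1) i(1) j(1) by blast
      then have "(0, w) \<in> (ray_graph n)\<^sup>*" using p(2) by simp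
      moreover have "\<forall>u\<le>n. v' \<in> nbhd u \<longrightarrow> u = w" using nbhd_unique w(2) by blast
      ultimately show ?thesis using v' w(1) j by blast
    next
      case False
      have "(v, v') \<in> conn n ({..n} - {p})"
        using v v' p(3) False \<open>n \<le> M\<close> vv' by (intro conn_step) (auto simp: region_def)
      then have "(R p i, v') \<in> conn n ({..n} - {p})" using i(2) conn_trans by blast
      then show ?thesis using v' p i(1) False by blast
    qed
  qed
  from inv[OF ab(4)] obtain p where "(0, p) \<in> (ray_graph n)\<^sup>*" "\<forall>w\<le>n. b \<in> nbhd w \<longrightarrow> w = p"
    by blast
  moreover have "b \<in> nbhd q" using ab(2) ray_in_nbhd by auto
  ultimately show ?thesis using assms by blast
qed

text \<open>
  A walk in the auxiliary graph lifts to the graph: consecutive connections are linked along the tails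
  of the rays that the walk visits, so only rays with index in \<open>S\<close> are approached.
\<close>

lemma ray_graph_walk_conn:
  assumes "(p, q) \<in> (ray_graph n \<inter> S \<times> S)\<^sup>*" "p \<in> S" "W \<subseteq> {..n}" "W \<inter> S = {}" "tail_start n p \<le> i"
  shows "tail_start n q \<le> j \<Longrightarrow> (R p i, R q j) \<in> conn n W"
  using assms(1)
proof (induction arbitrary: j rule: rtrancl_induct)
  case base
  then show ?case using assms by (intro tail_conn) auto
next
  case (step q q')
  then obtain k l where kl: "k \<ge> tail_start n q" "l \<ge> tail_start n q'"
    "(R q k, R q' l) \<in> conn n ({..n} - {q, q'})" unfolding ray_graph_def by blast
  have "W \<subseteq> {..n} - {q, q'}" "q' \<notin> W" using step.hyps(2) assms(3,4) by blast+
  then have "(R q k, R q' l) \<in> conn n W" "(R q' l, R q' j) \<in> conn n W"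
    using kl(3) conn_mono[OF order_refl] tail_conn[OF _ kl(2) step.prems] by blast+
  from conn_trans[OF step.IH[OF kl(1)] conn_trans[OF this]] show ?case .
qed

text \<open>
  In each auxiliary graph order the indices by breadth-first descent from \<open>0\<close>, pass to a sequence of
  values of \<open>n\<close> along which these orders converge, and select a homogeneous sequence \<open>x\<close> for the limit. If
  \<open>x\<close> is a chain, then a monotone walk between neighbours \<open>x k\<close> and \<open>x (Suc k)\<close> only visits indices
  between the two, and no other \<open>x j\<close> is among them. If \<open>x\<close> is an antichain, then the monotone walks
  from \<open>0\<close> to \<open>x k\<close> and to \<open>x (Suc k)\<close> visit no other \<open>x j\<close>, and together they link the two.
\<close>

lemma chain_of_joined_rays:
  "\<exists>x. inj x \<and> (\<forall>k m n. \<exists>a\<in>range (R (x k)). \<exists>b\<in>range (R (x (Suc k))).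
     let W = x ` ({..m} - {k, Suc k}) in a \<in> region n W \<and> (a, b) \<in> conn n W)"
proof -
  let ?D = "\<lambda>n. bfs (ray_graph n) 0"
  obtain s :: "nat \<Rightarrow> nat" and L where s: "strict_mono s"
    and L: "\<And>c. \<exists>n0. \<forall>n\<ge>n0. (prod_decode c \<in> (?D (s n))\<^sup>*) = L c"
    using diagonal_convergence[of "\<lambda>c n. prod_decode c \<in> (?D n)\<^sup>*"] by metis
  define anc where "anc p q \<longleftrightarrow> L (prod_encode (p, q))" for p q
  have anc: "\<exists>n0. \<forall>n\<ge>n0. ((p, q) \<in> (?D (s n))\<^sup>*) = anc p q" for p q
    using L[of "prod_encode (p, q)"] unfolding anc_def by simp
  obtain x :: "nat \<Rightarrow> nat" where mono: "strict_mono x" and types: "(\<forall>i j. i < j \<longrightarrow> anc (x i) (x j)) \<or>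
    (\<forall>i j. i < j \<longrightarrow> anc (x j) (x i)) \<or> (\<forall>i j. i \<noteq> j \<longrightarrow> \<not> anc (x i) (x j))"
    by (rule homogeneous_subsequence)
  have "inj x" using mono by (rule strict_mono_imp_inj_on)
  have "\<exists>a\<in>range (R (x k)). \<exists>b\<in>range (R (x (Suc k))).
     let W = x ` ({..m} - {k, Suc k}) in a \<in> region n W \<and> (a, b) \<in> conn n W" for k m n
  proof -
    define l where "l = m + k + 2"
    define n0 where "n0 p q = (SOME n0. \<forall>n\<ge>n0. ((p, q) \<in> (?D (s n))\<^sup>*) = anc p q)" for p q
    have n0: "((p, q) \<in> (?D (s N))\<^sup>*) = anc p q" if "N \<ge> n0 p q" for p q N
      using someI_ex[OF anc[of p q], folded n0_def] that by simp
    \<comment> \<open>A level from which on all pairs among the first rays are decided, and which exceeds \<open>n\<close> and their indices.\<close>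
    define F where "F = insert n ((\<lambda>(i, j). n0 (x i) (x j) + x i) ` ({..l} \<times> {..l}))"
    have "finite F" unfolding F_def by simp
    define N where "N = s (Max F)"
    have Max_le: "Max F \<le> N" unfolding N_def using s by (rule strict_mono_imp_increasing)
    have le: "n \<le> N" using Max_ge[OF \<open>finite F\<close>, of n] Max_le by (simp add: F_def)
    have ij: "n0 (x i) (x j) + x i \<le> Max F" if "i \<le> l" "j \<le> l" for i j
      using that by (intro Max_ge[OF \<open>finite F\<close>]) (auto simp: F_def)
    have xN: "x i \<le> N" if "i \<le> l" for i using ij[OF that that] Max_le by simp
    have D: "((x i, x j) \<in> (?D N)\<^sup>*) = anc (x i) (x j)" if "i \<le> l" "j \<le> l" for i j
      unfolding N_def using ij[OF that] by (intro n0) simp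
    define W where "W = x ` ({..m} - {k, Suc k})"
    let ?H = "ray_graph N \<inter> (- W) \<times> (- W)"
    have sym_H: "sym ?H" using sym_ray_graph[of N] by (auto simp: sym_def)
    have up: "(u, v) \<in> ?H\<^sup>*"
      if "(u, v) \<in> (?D N)\<^sup>*" "\<And>w. (u, w) \<in> (?D N)\<^sup>* \<Longrightarrow> (w, v) \<in> (?D N)\<^sup>* \<Longrightarrow> w \<notin> W" for u v
    proof -
      have "(u, v) \<in> (?D N \<inter> (- W) \<times> (- W))\<^sup>*" using that by (intro rtrancl_between) auto
      then show ?thesis by (rule rtrancl_mono[THEN subsetD, rotated]) (auto simp: bfs_def)
    qed
    have Wl: "\<exists>j\<le>l. j \<noteq> k \<and> j \<noteq> Suc k \<and> w = x j" if "w \<in> W" for w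
    proof -
      from that obtain j where "w = x j" "j \<in> {..m} - {k, Suc k}" unfolding W_def by (rule imageE)
      then show ?thesis unfolding l_def by (intro exI[of _ j]) simp
    qed
    have kl: "k \<le> l" "Suc k \<le> l" unfolding l_def by auto
    have anc_antisym: "i = j" if "i \<le> l" "j \<le> l" "anc (x i) (x j)" "anc (x j) (x i)" for i j
    proof -
      have "(x i, x j) \<in> (?D N)\<^sup>*" "(x j, x i) \<in> (?D N)\<^sup>*"
        using D[OF that(1,2)] D[OF that(2,1)] that(3,4) by blast+
      then have "x i = x j" by (rule bfs_antisym)
      with \<open>inj x\<close> show ?thesis by (rule injD)
    qed
    have "(x k, x (Suc k)) \<in> ?H\<^sup>*"
      using types
    proof (elim disjE)
      assume *: "\<forall>i j. i < j \<longrightarrow> anc (x i) (x j)"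
      show ?thesis
      proof (rule up)
        show "(x k, x (Suc k)) \<in> (?D N)\<^sup>*" using * D[OF kl] by simp
        fix w assume w: "(x k, w) \<in> (?D N)\<^sup>*" "(w, x (Suc k)) \<in> (?D N)\<^sup>*"
        show "w \<notin> W"
        proof
          assume "w \<in> W"
          from Wl[OF this] obtain j where j: "j \<le> l" "j \<noteq> k" "j \<noteq> Suc k" "w = x j" by blast
          then have "anc (x k) (x j)" "anc (x j) (x (Suc k))" using w D[OF j(1)] D[OF _ j(1)] kl by auto
          moreover have "j < k \<or> Suc k < j" using j(2,3) by linarith
          ultimately show False using * anc_antisym[OF j(1)] kl j(2,3) by blast
        qed
      qed
    next
      assume *: "\<forall>i j. i < j \<longrightarrow> anc (x j) (x i)"
      have "(x (Suc k), x k) \<in> ?H\<^sup>*"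
      proof (rule up)
        show "(x (Suc k), x k) \<in> (?D N)\<^sup>*" using * D[OF kl(2,1)] by simp
        fix w assume w: "(x (Suc k), w) \<in> (?D N)\<^sup>*" "(w, x k) \<in> (?D N)\<^sup>*"
        show "w \<notin> W"
        proof
          assume "w \<in> W"
          from Wl[OF this] obtain j where j: "j \<le> l" "j \<noteq> k" "j \<noteq> Suc k" "w = x j" by blast
          then have "anc (x (Suc k)) (x j)" "anc (x j) (x k)" using w D[OF j(1)] D[OF _ j(1)] kl by auto
          moreover have "j < k \<or> Suc k < j" using j(2,3) by linarith
          ultimately show False using * anc_antisym[OF j(1)] kl j(2,3) by blast
        qed
      qed
      then show ?thesis by (rule sym_rtranclD[OF sym_H])
    next
      assume *: "\<forall>i j. i \<noteq> j \<longrightarrow> \<not> anc (x i) (x j)"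
      have "(0, x i) \<in> ?H\<^sup>*" if i: "i = k \<or> i = Suc k" for i
      proof (rule up)
        have "i \<le> l" using i kl by auto
        show "(0, x i) \<in> (?D N)\<^sup>*"
          using ray_graph_connected[OF xN[OF \<open>i \<le> l\<close>]] by (rule bfs_reaches)
        fix w assume w: "(w, x i) \<in> (?D N)\<^sup>*"
        show "w \<notin> W"
        proof
          assume "w \<in> W"
          from Wl[OF this] obtain j where j: "j \<le> l" "j \<noteq> k" "j \<noteq> Suc k" "w = x j" by blast
          then have "anc (x j) (x i)" using w D[OF j(1) \<open>i \<le> l\<close>] by simp
          with * i j show False by auto
        qed
      qed
      from rtrancl_trans[OF sym_rtranclD[OF sym_H this[of k]] this[of "Suc k"]] show ?thesis by simp
    qed
    moreover have "W \<subseteq> {..N}" using Wl xN by blast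
    moreover have nW: "x k \<notin> W" unfolding W_def using \<open>inj x\<close> by (auto simp: inj_eq)
    ultimately have "(R (x k) (tail_start N (x k)), R (x (Suc k)) (tail_start N (x (Suc k)))) \<in> conn N W"
      by (intro ray_graph_walk_conn[of "x k" _ N "- W"]) auto
    moreover have "R (x k) (tail_start N (x k)) \<in> region n W"
      using tail_in_region[OF nW order_refl, of N] le by (simp add: region_def)
    ultimately show ?thesis using conn_mono[OF le, of W W] unfolding Let_def W_def[symmetric] by blast
  qed
  with \<open>inj x\<close> show ?thesis by blast
qed

end

section \<open>The order of construction of the half-grid\<close>

text \<open>
  The half-grid is built one horizontal branch path at a time; the path from column \<open>m\<close> to column
  \<open>m + 1\<close> in row \<open>n\<close> is built at time \<open>slot m n\<close>. The diagonal enumeration is such that the paths that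
  end on a given column \<open>m\<close> come row by row, the path from the left before the path to the right.
\<close>

definition slot :: "nat \<Rightarrow> nat \<Rightarrow> nat" where
  "slot m n = prod_encode (n, m)"

text \<open>
  The time of the first horizontal path that ends on the branch set in column \<open>m\<close> and row \<open>n\<close>. Column
  \<open>0\<close> has no path from the left; there truncated subtraction gives the time of the path to the right.
\<close>

definition first_slot :: "nat \<Rightarrow> nat \<Rightarrow> nat" where
  "first_slot m n = slot (m - 1) n"

lemma slot_less: "slot m n < slot (m - 1) (Suc n)"
  by (cases m) (auto simp: slot_def prod_encode_def)

lemma first_slot_le: "first_slot m n \<le> slot m n"
  by (cases m) (auto simp: first_slot_def slot_def prod_encode_def)

lemma first_slot_Suc: "first_slot (Suc m) n = slot m n"
  by (simp add: first_slot_def)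

text \<open>
  In each column the time intervals of the branch sets are disjoint and ordered by row, so that gaps
  remain for the vertical branch paths.
\<close>

lemma slot_less_first_slot: "n < n' \<Longrightarrow> slot m n < first_slot m n'"
proof (induction n' rule: less_induct)
  case (less n')
  then obtain k where k: "n' = Suc k" by (cases n') auto
  have "slot m k < first_slot m n'" using slot_less k by (simp add: first_slot_def)
  moreover have "slot m n \<le> slot m k"
    using less.IH[of k] less.prems first_slot_le[of m k] k by (cases "n = k") auto
  ultimately show ?case by simp
qed

lemma first_slot_mono: "n \<le> n' \<Longrightarrow> first_slot m n \<le> first_slot m n'"
  using slot_less_first_slot[of n n' m] first_slot_le[of m n] by (cases "n = n'") auto

lemma slot_mono: "n \<le> n' \<Longrightarrow> slot m n \<le> slot m n'"
  using slot_less_first_slot[of n n' m] first_slot_le[of m n'] by (cases "n = n'") auto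

lemma column_le_first_slot: "m \<le> Suc (first_slot m n)"
  using le_prod_encode_2[of "m - 1" n] by (simp add: first_slot_def slot_def)

lemma column_le_slot: "m \<le> slot m n"
  using le_prod_encode_2[of m n] by (simp add: slot_def)

lemma slot_eq_iff: "slot m n = slot m' n' \<longleftrightarrow> m = m' \<and> n = n'"
  by (auto simp: slot_def)

lemma half_grid_arc_cases:
  assumes "(x, y) \<in> parcs half_grid"
  obtains m n where "x = (m, n) \<and> y = (Suc m, n) \<or> y = (m, n) \<and> x = (Suc m, n)"
  | m n where "x = (m, n) \<and> y = (m, Suc n) \<or> y = (m, n) \<and> x = (m, Suc n)"
proof -
  obtain a b c d where xy: "x = (a, b)" "y = (c, d)" by fastforce
  then have "\<bar>int a - int c\<bar> + \<bar>int b - int d\<bar> = 1" using assms by (simp add: half_grid_def)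
  note dist = this
  show thesis
  proof (cases a c rule: linorder_cases)
    case less
    with dist have "c = Suc a" "b = d" by linarith+
    then show thesis using that(1)[of a b] xy by simp
  next
    case greater
    with dist have "a = Suc c" "b = d" by linarith+
    then show thesis using that(1)[of c b] xy by simp
  next
    case equal
    show thesis
    proof (cases "b < d")
      case True
      with dist equal have "d = Suc b" by linarith
      then show thesis using that(2)[of a b] xy equal by simp
    next
      case False
      with dist equal have "b = Suc d" by linarith
      then show thesis using that(2)[of a d] xy equal by simp
    qed
  qed
qed

lemma half_grid_edge_cases:
  assumes "e \<in> graph_edges half_grid"
  obtains m n where "e = {(m, n), (Suc m, n)}" | m n where "e = {(m, n), (m, Suc n)}"
proof -
  obtain x y where xy: "(x, y) \<in> parcs half_grid" "e = {x, y}"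
    using assms by (auto simp: graph_edges_def)
  from xy(1) show thesis
  proof (cases rule: half_grid_arc_cases)
    case (1 m n)
    then have "e = {(m, n), (Suc m, n)}" using xy(2) by blast
    then show thesis by (rule that(1))
  next
    case (2 m n)
    then have "e = {(m, n), (m, Suc n)}" using xy(2) by blast
    then show thesis by (rule that(2))
  qed
qed

section \<open>The half-grid along linked rays\<close>

text \<open>
  The input of the construction of the half-grid: rays pairwise far apart, consecutive ones joined
  arbitrarily high up by paths that are far from any finite number of the others. The height stands
  for the distance from a base vertex.
\<close>

locale linked_rays =
  fixes G :: "'a pair_pre_digraph" and S :: "nat \<Rightarrow> nat \<Rightarrow> 'a" and K :: nat
    and component :: "'a set" and height :: "'a \<Rightarrow> nat"
  assumes graph: "pair_bidirected_digraph G"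
    and K_pos: "0 < K"
    and ray_inj: "\<And>i. inj (S i)"
    and ray_step: "\<And>i n. (S i n, S i (Suc n)) \<in> parcs G"
    and ray_component: "\<And>i n. S i n \<in> component"
    and rays_far: "\<And>i j. i \<noteq> j \<Longrightarrow> far (parcs G) K (range (S i)) (range (S j))"
    and height_lipschitz: "\<And>u v j. u \<in> component \<Longrightarrow> (u, v) \<in> parcs G ^^ j \<Longrightarrow> height v \<le> height u + j"
    and ray_high: "\<And>i n. \<exists>M. \<forall>j\<ge>M. n \<le> height (S i j)"
    and linked: "\<And>k m n. \<exists>p. path_between G (range (S k)) p (range (S (Suc k))) \<and> set p \<subseteq> component \<and>
      (\<forall>v\<in>set p. n \<le> height v) \<and>
      (\<forall>j\<le>m. j \<noteq> k \<and> j \<noteq> Suc k \<longrightarrow> far (parcs G) K (set p) (range (S j)))"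
begin

lemma arcs_sym: "sym (parcs G)"
  using graph by (simp add: pair_bidirected_digraph_def sym_parcs)

lemma ray_verts: "range (S i) \<subseteq> pverts G"
  using ray_step graph
  by (auto simp: pair_bidirected_digraph_def pair_sym_digraph_def pair_wf_digraph_def)

text \<open>
  A walk of \<open>j\<close> arcs gains at most height \<open>j\<close>.
\<close>

lemma far_by_height:
  assumes "X \<subseteq> component" "\<And>x. x \<in> X \<Longrightarrow> height x \<le> n" "\<And>y. y \<in> Y \<Longrightarrow> n + K \<le> height y"
  shows "far (parcs G) K X Y"
  unfolding far_def
proof (intro ballI allI impI notI)
  fix x y j assume "x \<in> X" "y \<in> Y" "j < K" "(x, y) \<in> parcs G ^^ j"
  with height_lipschitz[of x y j] assms(1) assms(2)[of x] assms(3)[of y] show False by fastforce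
qed

text \<open>
  One step of the construction, for the first \<open>s + 2\<close> rays: above the level \<open>l\<close> it finds an index \<open>N\<close>
  where these rays are cut and a path \<open>p\<close> from column \<open>c\<close> to column \<open>c + 1\<close>, and \<open>l'\<close> bounds the height
  of all that has been used. The path and the rays from index \<open>N\<close> on keep height \<open>K\<close> above \<open>l\<close>.
\<close>

definition band :: "nat \<Rightarrow> nat \<Rightarrow> nat \<Rightarrow> nat \<Rightarrow> 'a list \<Rightarrow> nat \<Rightarrow> bool" where
  "band s c l N p l' \<longleftrightarrow> l \<le> l' \<and>
     (\<forall>m\<le>Suc s. (\<forall>i\<ge>N. l + K \<le> height (S m i)) \<and> (\<forall>i\<le>N. height (S m i) \<le> l')) \<and>
     path_between G (range (S c)) p (range (S (Suc c))) \<and> set p \<subseteq> component \<and>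
     (\<forall>v\<in>set p. l + K \<le> height v \<and> height v \<le> l') \<and>
     (\<forall>j\<le>Suc s. j \<noteq> c \<and> j \<noteq> Suc c \<longrightarrow> far (parcs G) K (set p) (range (S j)))"

lemma band_exists: "\<exists>N p l'. band s c l N p l'"
proof -
  obtain M where M: "\<And>m j. M m \<le> j \<Longrightarrow> l + K \<le> height (S m j)"
    using ray_high[of "l + K"] by metis
  define N where "N = Max (M ` {..Suc s})"
  have N: "M m \<le> N" if "m \<le> Suc s" for m
    using that unfolding N_def by (intro Max_ge) auto
  obtain p where p: "path_between G (range (S c)) p (range (S (Suc c)))" "set p \<subseteq> component"
    "\<forall>v\<in>set p. l + K \<le> height v"
    "\<forall>j\<le>Suc s. j \<noteq> c \<and> j \<noteq> Suc c \<longrightarrow> far (parcs G) K (set p) (range (S j))"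
    using linked[of c "l + K" "Suc s"] by blast
  define B where "B = height ` set p \<union> (\<lambda>(m, i). height (S m i)) ` ({..Suc s} \<times> {..N})"
  have "finite B" unfolding B_def by simp
  then obtain b where b: "\<And>x. x \<in> B \<Longrightarrow> x \<le> b" by (meson finite_nat_set_iff_bounded_le)
  have b1: "height v \<le> l + b" if "v \<in> set p" for v
    using b[of "height v"] that by (auto simp: B_def)
  have b2: "height (S m i) \<le> l + b" if "m \<le> Suc s" "i \<le> N" for m i
    using b[of "height (S m i)"] that by (force simp: B_def)
  have "band s c l N p (l + b)"
    unfolding band_def
  proof (intro conjI allI impI ballI)
    show "l + K \<le> height (S m i)" if "m \<le> Suc s" "N \<le> i" for m i
      using M[OF order_trans[OF N[OF that(1)] that(2)]] .
  qed (use p b1 b2 in auto)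
  then show ?thesis by blast
qed

end

text \<open>
  The bands of all steps, stacked. Time \<open>t\<close> of the enumeration of horizontal paths takes the three steps
  \<open>3 * t\<close>, \<open>3 * t + 1\<close> and \<open>3 * t + 2\<close>: the path of the middle step is used, and the cuts of the outer two
  leave a buffer on both sides. Hence the column is read off \<open>s div 3\<close>.
\<close>

locale banded_rays = linked_rays G S K component height
  for G :: "'a pair_pre_digraph" and S K component height +
  fixes N :: "nat \<Rightarrow> nat" and Q :: "nat \<Rightarrow> 'a list" and l :: "nat \<Rightarrow> nat"
  assumes band: "\<And>s. band s (snd (prod_decode (s div 3))) (l s) (N s) (Q s) (l (Suc s))"
begin

abbreviation col :: "nat \<Rightarrow> nat" where "col s \<equiv> snd (prod_decode (s div 3))"

lemma l_mono:
  assumes "s \<le> s'"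
  shows "l s \<le> l s'"
proof -
  have "l s \<le> l (Suc s)" for s using band[of s] by (simp add: band_def)
  then show ?thesis using assms by (rule lift_Suc_mono_le)
qed

lemma ray_above: "m \<le> Suc s \<Longrightarrow> N s \<le> i \<Longrightarrow> l s + K \<le> height (S m i)"
  and ray_below: "m \<le> Suc s \<Longrightarrow> i \<le> N s \<Longrightarrow> height (S m i) \<le> l (Suc s)"
  using band[of s] by (auto simp: band_def)

lemma Q_path: "path_between G (range (S (col s))) (Q s) (range (S (Suc (col s))))"
  and Q_component: "set (Q s) \<subseteq> component"
  and Q_above: "v \<in> set (Q s) \<Longrightarrow> l s + K \<le> height v"
  and Q_below: "v \<in> set (Q s) \<Longrightarrow> height v \<le> l (Suc s)"
  and Q_far_ray: "j \<le> Suc s \<Longrightarrow> j \<noteq> col s \<Longrightarrow> j \<noteq> Suc (col s) \<Longrightarrow>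
    far (parcs G) K (set (Q s)) (range (S j))"
  using band[of s] by (auto simp: band_def)

lemma N_less:
  assumes "s < s'"
  shows "N s < N s'"
proof -
  have "N s < N (Suc s)" for s
  proof (rule ccontr)
    assume "\<not> N s < N (Suc s)"
    then have "l (Suc s) + K \<le> height (S 0 (N s))" by (intro ray_above) auto
    moreover have "height (S 0 (N s)) \<le> l (Suc s)" by (rule ray_below) auto
    ultimately show False using K_pos by linarith
  qed
  then show ?thesis using assms by (rule lift_Suc_mono_less)
qed

lemma N_mono: "s \<le> s' \<Longrightarrow> N s \<le> N s'"
  using N_less[of s s'] by (cases "s = s'") auto

definition seg :: "nat \<Rightarrow> nat \<Rightarrow> nat \<Rightarrow> 'a set" where
  "seg m u v = S m ` {N u..N v}"

lemma seg_component: "seg m u v \<subseteq> component"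
  unfolding seg_def using ray_component by blast

lemma seg_Int_seg:
  assumes "u \<le> v" "v \<le> w"
  shows "seg m u v \<inter> seg m v w = {S m (N v)}"
proof -
  have "{N u..N v} \<inter> {N v..N w} = {N v}" using N_mono[OF assms(1)] N_mono[OF assms(2)] by auto
  then show ?thesis unfolding seg_def image_Int[OF ray_inj, symmetric] by simp
qed

lemma seg_above: "m \<le> Suc u \<Longrightarrow> y \<in> seg m u v \<Longrightarrow> l u + K \<le> height y"
  unfolding seg_def using ray_above by fastforce

lemma seg_below: "m \<le> Suc v \<Longrightarrow> x \<in> seg m u v \<Longrightarrow> height x \<le> l (Suc v)"
  unfolding seg_def using ray_below by fastforce

text \<open>
  Different columns are far apart by assumption; in one column the later segment is higher.
\<close>

lemma seg_far_seg:
  assumes "m \<noteq> m' \<or> m \<le> Suc v \<and> v < u'" "m' \<le> Suc u'"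
  shows "far (parcs G) K (seg m u v) (seg m' u' v')"
proof (cases "m = m'")
  case False
  then show ?thesis by (rule far_mono[OF rays_far order_refl]) (auto simp: seg_def)
next
  case True
  with assms have "m \<le> Suc v" "Suc v \<le> u'" by auto
  with assms(2) show ?thesis
    by (intro far_by_height[OF seg_component, of _ _ _ "l u'"] seg_above order_trans[OF seg_below l_mono])
qed

text \<open>
  The path of step \<open>s\<close> is above all that was cut before \<open>s\<close> and below all that starts after \<open>s\<close>. The third
  case covers the columns that the path does not join: those with index up to \<open>s + 1\<close> it avoids by
  construction, and on the remaining ones \<open>m \<le> Suc u\<close> forces \<open>s < u\<close>.
\<close>

lemma Q_far_seg:
  assumes "m \<le> Suc u" "u \<le> v" "v < s \<or> s < u \<or> m \<noteq> col s \<and> m \<noteq> Suc (col s)"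
  shows "far (parcs G) K (set (Q s)) (seg m u v)"
proof -
  consider "Suc v \<le> s" | "Suc s \<le> u" | "m \<le> Suc s" "m \<noteq> col s" "m \<noteq> Suc (col s)"
    using assms by linarith
  then show ?thesis
  proof cases
    case 1
    have "m \<le> Suc v" using assms(1,2) by simp
    then have "far (parcs G) K (seg m u v) (set (Q s))"
      using 1 by (intro far_by_height[OF seg_component, of _ _ _ "l s"] order_trans[OF seg_below l_mono] Q_above)
    then show ?thesis by (rule far_sym[OF arcs_sym])
  next
    case 2
    with assms(1) show ?thesis
      by (intro far_by_height[OF Q_component, of _ "l u"] order_trans[OF Q_below l_mono] seg_above)
  next
    case 3
    show ?thesis by (rule far_mono[OF Q_far_ray[OF 3] order_refl]) (auto simp: seg_def)
  qed
qed

lemma Q_far_Q: "s < s' \<Longrightarrow> far (parcs G) K (set (Q s)) (set (Q s'))"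
  by (intro far_by_height[OF Q_component, of _ "l s'"] order_trans[OF Q_below l_mono] Q_above Suc_leI)

text \<open>
  The branch set in column \<open>m\<close> and row \<open>n\<close> is a segment of the \<open>m\<close>-th ray that spans the times of the two
  horizontal paths that end on it.
\<close>

definition branch_set :: "nat \<times> nat \<Rightarrow> 'a set" where
  "branch_set = (\<lambda>(m, n). seg m (3 * first_slot m n) (3 * slot m n + 2))"

definition vertical :: "nat \<Rightarrow> nat \<Rightarrow> 'a list" where
  "vertical m n = map (S m) [N (3 * slot m n + 2)..<Suc (N (3 * first_slot m (Suc n)))]"

definition horizontal :: "nat \<Rightarrow> nat \<Rightarrow> 'a list" where
  "horizontal m n = Q (3 * slot m n + 1)"

text \<open>
  Both endpoints of a horizontal edge have the same second coordinate and both endpoints of a vertical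
  edge the same first one, so an edge is determined by its lower left corner and its direction.
\<close>

definition branch_path :: "(nat \<times> nat) set \<Rightarrow> 'a list" where
  "branch_path e = (if Min (fst ` e) < Max (fst ` e) then horizontal else vertical)
     (Min (fst ` e)) (Min (snd ` e))"

lemma branch_path_simps [simp]:
  "branch_path {(m, n), (Suc m, n)} = horizontal m n"
  "branch_path {(m, n), (m, Suc n)} = vertical m n"
  by (auto simp: branch_path_def)

lemma branch_set_simp:
  "branch_set (m, n) = seg m (3 * first_slot m n) (3 * slot m n + 2)"
  by (simp add: branch_set_def)

lemma set_vertical: "set (vertical m n) = seg m (3 * slot m n + 2) (3 * first_slot m (Suc n))"
  unfolding vertical_def seg_def by (auto simp del: upt_Suc)

lemma col_slot: "col (3 * slot m n + 1) = m"
proof -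
  have "(3 * slot m n + 1) div 3 = slot m n" by simp
  then show ?thesis unfolding slot_def by (simp only: prod_encode_inverse snd_conv)
qed

lemma column_le: "m \<le> Suc (3 * first_slot m n)" "m \<le> Suc (3 * slot m n + 2)"
  using column_le_first_slot[of m n] column_le_slot[of m n] by auto

lemma horizontal_far_seg:
  assumes "m' \<le> Suc u" "u \<le> v"
    and "m' = m \<or> m' = Suc m \<Longrightarrow> v < 3 * slot m n + 1 \<or> 3 * slot m n + 1 < u"
  shows "far (parcs G) K (set (horizontal m n)) (seg m' u v)"
  unfolding horizontal_def
  by (rule Q_far_seg[OF assms(1,2)]) (use assms(3) col_slot[of m n] in blast)

lemma branch_sets_far:
  assumes "x \<noteq> y"
  shows "far (parcs G) K (branch_set x) (branch_set y)"
proof -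
  have *: "far (parcs G) K (branch_set (m, n)) (branch_set (m', n'))" if "m \<noteq> m' \<or> n < n'" for m n m' n'
    unfolding branch_set_simp using that slot_less_first_slot[of n n' m] column_le[of m n] column_le[of m' n']
    by (intro seg_far_seg) auto
  obtain m n m' n' where xy: "x = (m, n)" "y = (m', n')" by fastforce
  consider "m \<noteq> m' \<or> n < n'" | "m' \<noteq> m \<or> n' < n" using assms xy by force
  then show ?thesis unfolding xy using * far_sym[OF arcs_sym *] by cases blast+
qed

lemma vertical_far_branch_set:
  assumes "x \<noteq> (m, n)" "x \<noteq> (m, Suc n)"
  shows "far (parcs G) K (set (vertical m n)) (branch_set x)"
proof -
  obtain m' n' where x: "x = (m', n')" by fastforce
  consider "m \<noteq> m'" | "m' = m" "n' < n" | "m' = m" "Suc n < n'" using assms x by fastforce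
  then show ?thesis
  proof cases
    case 1
    then show ?thesis unfolding set_vertical x branch_set_simp
      using column_le by (intro seg_far_seg) auto
  next
    case 2
    have "slot m n' < slot m n" using slot_less_first_slot[OF 2(2), of m] first_slot_le[of m n] by simp
    then have "far (parcs G) K (branch_set x) (set (vertical m n))"
      unfolding set_vertical x branch_set_simp using 2 column_le by (intro seg_far_seg) auto
    then show ?thesis by (rule far_sym[OF arcs_sym])
  next
    case 3
    have "first_slot m (Suc n) < first_slot m n'"
      using slot_less_first_slot[OF 3(2), of m] first_slot_le[of m "Suc n"] by simp
    then show ?thesis unfolding set_vertical x branch_set_simp
      using 3 column_le by (intro seg_far_seg) auto
  qed
qed

lemma verticals_far:
  assumes "(m, n) \<noteq> (m', n')"
  shows "far (parcs G) K (set (vertical m n)) (set (vertical m' n'))"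
proof -
  have *: "far (parcs G) K (set (vertical m n)) (set (vertical m' n'))" if "m \<noteq> m' \<or> n < n'" for m n m' n'
  proof -
    have "first_slot m (Suc n) \<le> slot m n'" if "n < n'"
      using first_slot_mono[of "Suc n" n' m] first_slot_le[of m n'] that by simp
    then show ?thesis
      unfolding set_vertical using that column_le by (intro seg_far_seg) auto
  qed
  consider "m \<noteq> m' \<or> n < n'" | "m' \<noteq> m \<or> n' < n" using assms by force
  then show ?thesis using * far_sym[OF arcs_sym *] by cases blast+
qed

lemma horizontals_far:
  assumes "(m, n) \<noteq> (m', n')"
  shows "far (parcs G) K (set (horizontal m n)) (set (horizontal m' n'))"
proof -
  have "slot m n \<noteq> slot m' n'" using assms by (simp add: slot_eq_iff)
  then consider "slot m n < slot m' n'" | "slot m' n' < slot m n" by linarith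
  then show ?thesis
    unfolding horizontal_def by cases (auto intro: Q_far_Q far_sym[OF arcs_sym Q_far_Q])
qed

text \<open>
  The time of a horizontal path that ends on column \<open>m'\<close> lies in the interval of a branch set of that
  column, and the vertical paths use the gaps between these intervals.
\<close>

lemma horizontal_far_vertical:
  "far (parcs G) K (set (horizontal m n)) (set (vertical m' n'))"
  unfolding set_vertical
proof (rule horizontal_far_seg)
  show "m' \<le> Suc (3 * slot m' n' + 2)" by (rule column_le)
  show "3 * slot m' n' + 2 \<le> 3 * first_slot m' (Suc n')"
    using slot_less_first_slot[of n' "Suc n'" m'] by simp
  assume m': "m' = m \<or> m' = Suc m"
  have t: "first_slot m' n \<le> slot m n" "slot m n \<le> slot m' n"
    using m' first_slot_le[of m n] first_slot_le[of "Suc m" n] by (auto simp: first_slot_Suc)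
  show "3 * first_slot m' (Suc n') < 3 * slot m n + 1 \<or> 3 * slot m n + 1 < 3 * slot m' n' + 2"
  proof (cases "n' < n")
    case True
    then show ?thesis using first_slot_mono[of "Suc n'" n m'] t by simp
  next
    case False
    then show ?thesis using slot_mono[of n n' m'] t by simp
  qed
qed

lemma horizontal_far_branch_set:
  assumes "x \<noteq> (m, n)" "x \<noteq> (Suc m, n)"
  shows "far (parcs G) K (set (horizontal m n)) (branch_set x)"
proof -
  obtain m' n' where x: "x = (m', n')" by fastforce
  show ?thesis
    unfolding x branch_set_simp
  proof (rule horizontal_far_seg)
    show "m' \<le> Suc (3 * first_slot m' n')" by (rule column_le)
    show "3 * first_slot m' n' \<le> 3 * slot m' n' + 2" using first_slot_le[of m' n'] by simp
    assume m': "m' = m \<or> m' = Suc m"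
    have t: "first_slot m' n \<le> slot m n" "slot m n \<le> slot m' n"
      using m' first_slot_le[of m n] first_slot_le[of "Suc m" n] by (auto simp: first_slot_Suc)
    have "n' < n \<or> n < n'" using assms x m' by auto
    then show "3 * slot m' n' + 2 < 3 * slot m n + 1 \<or> 3 * slot m n + 1 < 3 * first_slot m' n'"
      using slot_less_first_slot[of n' n m'] slot_less_first_slot[of n n' m'] t by auto
  qed
qed

lemma vertical_path: "path_between G (branch_set (m, n)) (vertical m n) (branch_set (m, Suc n))"
proof -
  let ?a = "N (3 * slot m n + 2)" and ?b = "N (3 * first_slot m (Suc n))"
  have less: "?a < ?b" using slot_less_first_slot[of n "Suc n" m] by (intro N_less) simp
  have "vpath (vertical m n) (with_proj G)"
    unfolding vertical_def using less
    by (intro map_ray_vpath ray_inj ray_step ray_verts) simp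
  moreover have "hd (vertical m n) = S m ?a" "last (vertical m n) = S m ?b"
    unfolding vertical_def using less by (simp_all add: hd_map last_map del: upt_Suc)
  moreover have "set (vertical m n) \<inter> branch_set (m, n) = {S m ?a}"
    unfolding set_vertical branch_set_simp Int_commute[of "seg m (3 * slot m n + 2) _"]
    using first_slot_le[of m n] slot_less_first_slot[of n "Suc n" m] by (intro seg_Int_seg) auto
  moreover have "set (vertical m n) \<inter> branch_set (m, Suc n) = {S m ?b}"
    unfolding set_vertical branch_set_simp
    using first_slot_le[of m "Suc n"] slot_less_first_slot[of n "Suc n" m] by (intro seg_Int_seg) auto
  ultimately show ?thesis unfolding path_between_def by simp
qed

text \<open>
  The path is constructed from ray to ray; the heights force its endpoints into the segment between the
  cuts of the steps before and after its own.
\<close>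

lemma horizontal_path: "path_between G (branch_set (m, n)) (horizontal m n) (branch_set (Suc m, n))"
proof -
  let ?s = "3 * slot m n + 1" and ?p = "horizontal m n"
  have p: "path_between G (range (S m)) ?p (range (S (Suc m)))"
    using Q_path[of ?s] unfolding col_slot horizontal_def .
  have idx: "N (3 * slot m n) \<le> i \<and> i \<le> N (3 * slot m n + 2)"
    if "S j i \<in> set ?p" "j \<le> Suc m" for i j
  proof -
    have j: "j \<le> Suc (slot m n)" using that(2) column_le_slot[of m n] by simp
    have h: "l ?s + K \<le> height (S j i)" "height (S j i) \<le> l (Suc ?s)"
      using that(1) Q_above Q_below unfolding horizontal_def by blast+
    have "\<not> i \<le> N (3 * slot m n)" using ray_below[of j "3 * slot m n" i] j h(1) K_pos by force
    moreover have "\<not> N (3 * slot m n + 2) \<le> i"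
      using ray_above[of j "3 * slot m n + 2" i] j h(2) K_pos by force
    ultimately show ?thesis by simp
  qed
  note ends = path_between_ends[OF p]
  obtain i where i: "hd ?p = S m i" using ends(3) by blast
  obtain j where j: "last ?p = S (Suc m) j" using ends(4) by blast
  have "N (3 * first_slot m n) \<le> N (3 * slot m n)" "N (3 * slot m n + 2) \<le> N (3 * slot (Suc m) n + 2)"
    using first_slot_le[of m n] first_slot_le[of "Suc m" n]
    by (simp_all add: N_mono first_slot_Suc)
  then have "hd ?p \<in> branch_set (m, n)" "last ?p \<in> branch_set (Suc m, n)"
    using idx[of m i] idx[of "Suc m" j] ends(1,2) i j
    by (auto simp: branch_set_simp seg_def first_slot_Suc)
  moreover have "branch_set (m, n) \<subseteq> range (S m)" "branch_set (Suc m, n) \<subseteq> range (S (Suc m))"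
    by (auto simp: branch_set_simp seg_def)
  ultimately show ?thesis using path_between_subset[OF p] by blast
qed

lemma branch_set_connected: "Digraph_Component.connected (with_proj G \<restriction> branch_set x)"
proof -
  obtain m n where x: "x = (m, n)" by fastforce
  let ?a = "N (3 * first_slot m n)" and ?b = "N (3 * slot m n + 2)"
  let ?X = "S m ` {?a..?b}"
  have X: "branch_set x = ?X" by (simp add: x branch_set_simp seg_def)
  have le: "?a \<le> ?b" using first_slot_le[of m n] by (intro N_mono) simp
  have up: "(S m ?a, S m (?a + k)) \<in> (parcs G \<inter> ?X \<times> ?X)\<^sup>*" if "?a + k \<le> ?b" for k
    using that
  proof (induction k)
    case (Suc k)
    have "(S m (?a + k), S m (?a + Suc k)) \<in> parcs G \<inter> ?X \<times> ?X"
      using ray_step[of m "?a + k"] Suc.prems by auto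
    with Suc show ?case by (auto intro: rtrancl_into_rtrancl)
  qed simp
  have from_a: "(S m ?a, v) \<in> (parcs G \<inter> ?X \<times> ?X)\<^sup>*" if v: "v \<in> ?X" for v
  proof -
    obtain i where "v = S m i" "?a \<le> i" "i \<le> ?b" using v by auto
    then show ?thesis using up[of "i - ?a"] by simp
  qed
  have sX: "sym (parcs G \<inter> ?X \<times> ?X)" by (rule symI) (auto dest: symD[OF arcs_sym])
  have "(u, v) \<in> (parcs G \<inter> ?X \<times> ?X)\<^sup>*" if "u \<in> ?X" "v \<in> ?X" for u v
    using rtrancl_trans[OF sym_rtranclD[OF sX from_a[OF that(1)]] from_a[OF that(2)]] .
  moreover have "pair_sym_digraph G" using graph by (simp add: pair_bidirected_digraph_def)
  moreover have "?X \<subseteq> pverts G" using ray_verts by blast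
  moreover have "?X \<noteq> {}" using le by simp
  ultimately show ?thesis unfolding X by (simp add: connected_induced_iff)
qed

lemma branch_path_far_branch_set:
  assumes "e \<in> graph_edges half_grid" "x \<notin> e"
  shows "far (parcs G) K (set (branch_path e)) (branch_set x)"
  using assms(1)
proof (cases rule: half_grid_edge_cases)
  case (1 m n)
  then show ?thesis using assms(2) by (simp add: horizontal_far_branch_set)
next
  case (2 m n)
  then show ?thesis using assms(2) by (simp add: vertical_far_branch_set)
qed

lemma branch_paths_far:
  assumes "e \<in> graph_edges half_grid" "f \<in> graph_edges half_grid" "e \<noteq> f"
  shows "far (parcs G) K (set (branch_path e)) (set (branch_path f))"
  using assms(1)
proof (cases rule: half_grid_edge_cases)
  case (1 m n)
  note e = this
  from assms(2) show ?thesis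
  proof (cases rule: half_grid_edge_cases)
    case (1 m' n')
    then have "(m, n) \<noteq> (m', n')" using e assms(3) by auto
    from horizontals_far[OF this] show ?thesis using e 1 by simp
  next
    case (2 m' n')
    then show ?thesis using e by (simp only: branch_path_simps horizontal_far_vertical)
  qed
next
  case (2 m n)
  note e = this
  from assms(2) show ?thesis
  proof (cases rule: half_grid_edge_cases)
    case (1 m' n')
    then show ?thesis using e by (simp only: branch_path_simps far_sym[OF arcs_sym horizontal_far_vertical])
  next
    case (2 m' n')
    then have "(m, n) \<noteq> (m', n')" using e assms(3) by auto
    from verticals_far[OF this] show ?thesis using e 2 by simp
  qed
qed

lemma branch_path_between:
  assumes "(x, y) \<in> parcs half_grid"
  shows "path_between G (branch_set x) (branch_path {x, y}) (branch_set y) \<or>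
    path_between G (branch_set y) (branch_path {x, y}) (branch_set x)"
  using assms
proof (cases rule: half_grid_arc_cases)
  case (1 m n)
  then show ?thesis using horizontal_path[of m n]
    by (auto simp: insert_commute)
next
  case (2 m n)
  then show ?thesis using vertical_path[of m n]
    by (auto simp: insert_commute)
qed

lemma branch_path_verts:
  assumes "e \<in> graph_edges half_grid"
  shows "set (branch_path e) \<subseteq> pverts G"
proof -
  obtain x y where xy: "(x, y) \<in> parcs half_grid" "e = {x, y}"
    using assms by (auto simp: graph_edges_def)
  then show ?thesis using branch_path_between[OF xy(1)]
    by (auto simp: path_between_def vpath_def vwalk_def)
qed

lemma fat_half_grid: "is_fat_model K half_grid G branch_set branch_path"
proof -
  have wf: "pair_wf_digraph G"
    using graph by (simp add: pair_bidirected_digraph_def pair_sym_digraph_def)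
  have bs: "branch_set x \<subseteq> pverts G" for x
    using ray_verts by (cases x) (auto simp: branch_set_simp seg_def)
  have inner: "inner_vertices p \<subseteq> set p" for p :: "'a list"
    unfolding inner_vertices_def by (cases p) (auto dest: in_set_butlastD)
  show ?thesis
    unfolding is_fat_model_def is_model_def pairwise_def
  proof (intro conjI ballI impI allI)
    fix e f assume ef: "e \<in> graph_edges half_grid" "f \<in> graph_edges half_grid" "e \<noteq> f"
    note far = branch_paths_far[OF this]
    then show "disjnt (inner_vertices (branch_path e)) (set (branch_path f))"
      using far_imp_disjnt[OF far K_pos] inner disjnt_subset1 by blast
    show "enat K \<le> set_dist G (set (branch_path e)) (set (branch_path f))"
      using far le_set_dist_iff_far[OF wf branch_path_verts[OF ef(1)]] by blast
  next
    fix x y :: "nat \<times> nat" assume "x \<noteq> y"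
    note far = branch_sets_far[OF this]
    show "disjnt (branch_set x) (branch_set y)" by (rule far_imp_disjnt[OF far K_pos])
    show "enat K \<le> set_dist G (branch_set x) (branch_set y)"
      using far le_set_dist_iff_far[OF wf bs] by blast
  next
    fix e and x :: "nat \<times> nat" assume e: "e \<in> graph_edges half_grid" "x \<notin> e"
    note far = branch_path_far_branch_set[OF this]
    show "disjnt (set (branch_path e)) (branch_set x)" by (rule far_imp_disjnt[OF far K_pos])
    show "enat K \<le> set_dist G (set (branch_path e)) (branch_set x)"
      using far le_set_dist_iff_far[OF wf branch_path_verts[OF e(1)]] by blast
  next
    fix xy assume "xy \<in> parcs half_grid"
    then show "case xy of (x, y) \<Rightarrow> path_between G (branch_set x) (branch_path {x, y}) (branch_set y) \<or>
      path_between G (branch_set y) (branch_path {x, y}) (branch_set x)"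
      using branch_path_between[of "fst xy" "snd xy"] by (simp add: case_prod_beta)
  qed (use bs branch_set_connected in auto)
qed

end

context linked_rays
begin

theorem fat_half_grid_exists: "\<exists>V E. is_fat_model K half_grid G V E"
proof -
  define good where "good s l T = (case T of (N, p, l') \<Rightarrow> band s (snd (prod_decode (s div 3))) l N p l')"
    for s l and T :: "nat \<times> 'a list \<times> nat"
  have "\<exists>T. good s l T" for s l
    using band_exists[of s _ l] by (force simp: good_def)
  then obtain T where T: "\<And>s l. good s l (T s l)" by metis
  \<comment> \<open>The final level of each step is the initial level of the next.\<close>
  define l where "l = rec_nat 0 (\<lambda>s l. snd (snd (T s l)))"
  have "l (Suc s) = snd (snd (T s (l s)))" for s by (simp add: l_def)
  then have "band s (snd (prod_decode (s div 3))) (l s) (fst (T s (l s))) (fst (snd (T s (l s)))) (l (Suc s))" for s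
    using T[of s "l s"] by (simp add: good_def split: prod.splits)
  then interpret banded_rays G S K component height "\<lambda>s. fst (T s (l s))" "\<lambda>s. fst (snd (T s (l s)))" l
    by unfold_locales
  show ?thesis using fat_half_grid by blast
qed

end

section \<open>Rays in the given graph\<close>

lemma omega_rays_arc: "((i, n), (i, Suc n)) \<in> parcs omega_rays"
  by (simp add: omega_rays_def)

lemma omega_rays_edge: "{(i, n), (i, Suc n)} \<in> graph_edges omega_rays"
  unfolding graph_edges_def by (rule image_eqI[OF _ omega_rays_arc]) simp

text \<open>
  The branch sets and branch paths of one ray of the model form an infinite connected graph \<open>U i\<close>, which
  contains a ray by Koenig's lemma. Parts of the model that belong to different rays are never
  incident, so the sets \<open>U i\<close> are pairwise far.
\<close>

lemma far_rays_of_fat_omega_rays: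
  assumes graph: "pair_bidirected_digraph G" and lf: "locally_finite G"
    and fat: "is_fat_model M omega_rays G V E"
  shows "\<exists>R :: nat \<Rightarrow> nat \<Rightarrow> 'a. (\<forall>i. R i \<in> rays G) \<and>
    (\<forall>i j. i \<noteq> j \<longrightarrow> far (parcs G) M (range (R i)) (range (R j)))"
proof -
  have symG: "pair_sym_digraph G" and wf: "pair_wf_digraph G"
    using graph by (simp_all add: pair_bidirected_digraph_def pair_sym_digraph_def)
  note sym = sym_parcs[OF symG]
  let ?e = "\<lambda>(i :: nat) n. {(i, n), (i, Suc n)}"
  have mem: "x \<in> pverts omega_rays" for x by (simp add: omega_rays_def)
  have parts:
    "\<forall>x\<in>pverts omega_rays. V x \<subseteq> pverts G \<and> Digraph_Component.connected (with_proj G \<restriction> V x)"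
    "pairwise (\<lambda>x y. disjnt (V x) (V y)) (pverts omega_rays)"
    "\<forall>(x, y)\<in>parcs omega_rays.
       path_between G (V x) (E {x, y}) (V y) \<or> path_between G (V y) (E {x, y}) (V x)"
    "pairwise (\<lambda>x y. enat M \<le> set_dist G (V x) (V y)) (pverts omega_rays)"
    "pairwise (\<lambda>e f. enat M \<le> set_dist G (set (E e)) (set (E f))) (graph_edges omega_rays)"
    "\<forall>e\<in>graph_edges omega_rays. \<forall>x\<in>pverts omega_rays. x \<notin> e \<longrightarrow>
       enat M \<le> set_dist G (set (E e)) (V x)"
    using fat unfolding is_fat_model_def is_model_def by - (elim conjE, assumption)+
  have Vv: "V x \<subseteq> pverts G" and Vc: "Digraph_Component.connected (with_proj G \<restriction> V x)" for x
    using bspec[OF parts(1) mem[of x]] by simp_all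
  have Ep: "path_between G (V (i, n)) (E (?e i n)) (V (i, Suc n)) \<or>
      path_between G (V (i, Suc n)) (E (?e i n)) (V (i, n))" for i n
    using bspec[OF parts(3) omega_rays_arc[of i n]] by simp
  have Ev: "set (E (?e i n)) \<subseteq> pverts G" for i n
    using Ep[of i n] by (elim disjE path_between_verts)
  have Vdisj: "disjnt (V x) (V y)" if "x \<noteq> y" for x y
    using pairwiseD[OF parts(2) mem mem that] .
  have VV: "far (parcs G) M (V x) (V y)" if "x \<noteq> y" for x y
    using pairwiseD[OF parts(4) mem mem that] by (rule iffD1[OF le_set_dist_iff_far[OF wf Vv]])
  have EE: "far (parcs G) M (set (E (?e i n))) (set (E (?e j m)))" if "i \<noteq> j" for i j n m
  proof -
    have "?e i n \<noteq> ?e j m" using that by (simp add: doubleton_eq_iff)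
    from pairwiseD[OF parts(5) omega_rays_edge omega_rays_edge this] show ?thesis
      by (rule iffD1[OF le_set_dist_iff_far[OF wf Ev]])
  qed
  have EV: "far (parcs G) M (set (E (?e i n))) (V (j, m))" if "i \<noteq> j" for i j n m
  proof -
    have "(j, m) \<notin> ?e i n" using that by simp
    with parts(6) omega_rays_edge mem have "enat M \<le> set_dist G (set (E (?e i n))) (V (j, m))"
      by simp
    then show ?thesis by (rule iffD1[OF le_set_dist_iff_far[OF wf Ev]])
  qed
  define U where "U i = (\<Union>n. V (i, n) \<union> set (E (?e i n)))" for i
  have U_far: "far (parcs G) M (U i) (U j)" if "i \<noteq> j" for i j :: nat
    unfolding U_def
  proof (rule far_UN)
    fix n m
    have "far (parcs G) M (V (i, n)) (V (j, m))" using that by (intro VV) simp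
    then show "far (parcs G) M (V (i, n) \<union> set (E (?e i n))) (V (j, m) \<union> set (E (?e j m)))"
      unfolding far_Un using EV[OF that] EE[OF that] far_sym[OF sym EV[OF that[symmetric]]] by blast
  qed
  have ray: "\<exists>r. r \<in> rays G \<and> range r \<subseteq> U i" for i
  proof -
    let ?B = "parcs G \<inter> U i \<times> U i"
    have inV: "(u, v) \<in> ?B\<^sup>*" if "u \<in> V (i, n)" "v \<in> V (i, n)" for u v n
    proof -
      have "(u, v) \<in> (parcs G \<inter> V (i, n) \<times> V (i, n))\<^sup>*"
        using Vc connected_induced_iff[OF symG Vv] that by blast
      moreover have "parcs G \<inter> V (i, n) \<times> V (i, n) \<subseteq> ?B" unfolding U_def by blast
      ultimately show ?thesis using rtrancl_mono by blast
    qed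
    have symB: "sym ?B" by (rule symI) (auto dest: symD[OF sym])
    have E_conn: "(hd (E (?e i n)), last (E (?e i n))) \<in> ?B\<^sup>*" for n
    proof -
      have "vwalk (E (?e i n)) (with_proj G)"
        using Ep[of i n] by (auto simp: path_between_def vpath_def)
      then have "(hd (E (?e i n)), last (E (?e i n))) \<in> (parcs G \<inter> set (E (?e i n)) \<times> set (E (?e i n)))\<^sup>*"
        by (rule vwalk_connects)
      moreover have "parcs G \<inter> set (E (?e i n)) \<times> set (E (?e i n)) \<subseteq> ?B" unfolding U_def by blast
      ultimately show ?thesis using rtrancl_mono by blast
    qed
    have step: "\<exists>a\<in>V (i, n). \<exists>b\<in>V (i, Suc n). (a, b) \<in> ?B\<^sup>*" for n
      using Ep[of i n] path_between_ends(3,4) E_conn[of n] sym_rtranclD[OF symB E_conn[of n]] by blast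
    have ne: "V x \<noteq> {}" for x using Vc connected_induced_iff[OF symG Vv] by blast
    obtain root where root: "root \<in> V (i, 0)" using ne by blast
    have reach: "(root, v) \<in> ?B\<^sup>*" if "v \<in> V (i, n)" for v n
      using that
    proof (induction n arbitrary: v)
      case 0
      then show ?case using inV root by blast
    next
      case (Suc n)
      obtain a b where "a \<in> V (i, n)" "b \<in> V (i, Suc n)" "(a, b) \<in> ?B\<^sup>*" using step by blast
      then show ?case using Suc.IH[of a] inV[OF _ Suc.prems, of b] rtrancl_trans by metis
    qed
    \<comment> \<open>One vertex from each branch set shows that infinitely many vertices can be reached.\<close>
    define f where "f n = (SOME v. v \<in> V (i, n))" for n
    have f: "f n \<in> V (i, n)" for n unfolding f_def using ne some_in_eq by blast
    have "inj f"
    proof (rule injI)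
      fix n m assume "f n = f m"
      then show "n = m" using f[of n] f[of m] Vdisj[of "(i, n)" "(i, m)"] by (auto simp: disjnt_iff)
    qed
    then have "infinite (range f)" by (rule range_inj_infinite)
    moreover have "range f \<subseteq> {v. (root, v) \<in> ?B\<^sup>*}" using reach f by blast
    ultimately have "infinite {v. (root, v) \<in> ?B\<^sup>*}" using infinite_super by blast
    moreover have "finite (?B `` {v})" for v
      using locally_finite_image[OF graph lf, of v] by (rule finite_subset[rotated]) blast
    ultimately obtain r where r: "inj r" "\<And>n. (r n, r (Suc n)) \<in> ?B"
      using koenig[of ?B root] by blast
    then have "range r \<subseteq> U i" by blast
    moreover have "U i \<subseteq> pverts G" unfolding U_def using Vv Ev by blast
    ultimately have "r \<in> rays G \<and> range r \<subseteq> U i" unfolding rays_def using r by blast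
    then show ?thesis by blast
  qed
  then obtain R :: "nat \<Rightarrow> nat \<Rightarrow> 'a" where R: "\<And>i. R i \<in> rays G" "\<And>i. range (R i) \<subseteq> U i" by metis
  have "far (parcs G) M (range (R i)) (range (R j))" if "i \<noteq> j" for i j
    using far_mono[OF U_far[OF that] order_refl R(2) R(2)] .
  with R(1) show ?thesis by blast
qed

text \<open>
  Both rays are in the only end, so there are infinitely many disjoint paths between them, and a finite
  set meets only finitely many of those. That all rays are in the same class requires
  \<^const>\<open>ray_equiv\<close> to be reflexive, witnessed by the paths of length \<open>0\<close>.
\<close>

lemma one_ended_rays_joined:
  assumes wf: "pair_wf_digraph G" and "one_ended G" "r \<in> rays G" "s \<in> rays G" "finite X"
  shows "\<exists>a\<in>range r. \<exists>b\<in>range s. a \<notin> X \<and> (a, b) \<in> (parcs G \<inter> (- X) \<times> (- X))\<^sup>*"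
proof -
  have "ray_equiv G `` {r} \<in> graph_ends G" "ray_equiv G `` {s} \<in> graph_ends G"
    using assms(3,4) by (auto simp: graph_ends_def intro: quotientI)
  then have eq: "ray_equiv G `` {r} = ray_equiv G `` {s}" using assms(2) unfolding one_ended_def by blast
  have "(s, s) \<in> ray_equiv G"
  proof -
    let ?P = "range (\<lambda>n. [s n])"
    have "inj (\<lambda>n. [s n])" using assms(4) by (auto simp: rays_def inj_def)
    then have "infinite ?P" by (rule range_inj_infinite)
    moreover have "path_between G (range s) [s n] (range s)" for n
      using assms(4) by (auto simp: path_between_def vpath_def vwalk_def rays_def)
    moreover have "pairwise (\<lambda>p q. disjnt (set p) (set q)) ?P" by (auto simp: pairwise_def)
    ultimately show ?thesis using assms(4) unfolding ray_equiv_def by blast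
  qed
  then have "(r, s) \<in> ray_equiv G" using eq by blast
  then obtain P where P: "infinite P" "\<And>p. p \<in> P \<Longrightarrow> path_between G (range r) p (range s)"
    "pairwise (\<lambda>p q. disjnt (set p) (set q)) P" unfolding ray_equiv_def by blast
  have "\<exists>p\<in>P. set p \<inter> X = {}"
  proof (rule ccontr)
    assume "\<not> ?thesis"
    then have "\<forall>p\<in>P. \<exists>x. x \<in> set p \<and> x \<in> X" by blast
    then obtain g where g: "\<And>p. p \<in> P \<Longrightarrow> g p \<in> set p \<and> g p \<in> X" by metis
    have "inj_on g P"
    proof (rule inj_onI, rule ccontr)
      fix p q assume pq: "p \<in> P" "q \<in> P" "g p = g q" "p \<noteq> q"
      then have "disjnt (set p) (set q)" using P(3) unfolding pairwise_def by blast
      then show False using g[OF pq(1)] g[OF pq(2)] pq(3) unfolding disjnt_iff by metis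
    qed
    moreover have "finite (g ` P)" by (rule finite_subset[OF _ assms(5)]) (use g in blast)
    ultimately show False using P(1) finite_imageD by blast
  qed
  then obtain p where p: "p \<in> P" "set p \<inter> X = {}" by blast
  note path = P(2)[OF p(1)]
  have "(hd p, last p) \<in> (parcs G \<inter> set p \<times> set p)\<^sup>*"
    using path by (intro vwalk_connects) (simp add: path_between_def vpath_def)
  moreover have "parcs G \<inter> set p \<times> set p \<subseteq> parcs G \<inter> (- X) \<times> (- X)" using p(2) by blast
  ultimately have "(hd p, last p) \<in> (parcs G \<inter> (- X) \<times> (- X))\<^sup>*" using rtrancl_mono by blast
  then show ?thesis using path_between_ends[OF path] p(2) by blast
qed

section \<open>From rays to the half-grid\<close>

theorem theorem4:
  fixes G :: "'a pair_pre_digraph"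
  assumes "pair_bidirected_digraph G"
    and "one_ended G"
    and "locally_finite G"
    and "asymptotic_minor omega_rays G"
  shows "asymptotic_minor half_grid G"
  unfolding asymptotic_minor_def
proof
  fix K
  \<comment> \<open>Positive fatness makes far sets disjoint, as a model requires.\<close>
  define L where "L = Suc K"
  have symG: "pair_sym_digraph G" and wf: "pair_wf_digraph G"
    using assms(1) by (simp_all add: pair_bidirected_digraph_def pair_sym_digraph_def)
  note sym = sym_parcs[OF symG]
  obtain V E where "is_fat_model (2 * L + 1) omega_rays G V E"
    using assms(4) unfolding asymptotic_minor_def by blast
  then obtain R :: "nat \<Rightarrow> nat \<Rightarrow> 'a" where R: "\<And>i. R i \<in> rays G"
    and far: "\<And>i j. i \<noteq> j \<Longrightarrow> far (parcs G) (2 * L + 1) (range (R i)) (range (R j))"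
    using far_rays_of_fat_omega_rays[OF assms(1,3)] by metis
  interpret ray_family "parcs G" R L
  proof
    show "finite (parcs G `` {v})" for v by (rule locally_finite_image[OF assms(1,3)])
    show "\<exists>a\<in>range (R i). \<exists>b\<in>range (R j). a \<notin> X \<and> (a, b) \<in> (parcs G \<inter> (- X) \<times> (- X))\<^sup>*"
      if "finite X" for i j X
      using one_ended_rays_joined[OF wf assms(2) R R that] .
  qed (use sym R far in \<open>auto simp: rays_def\<close>)
  obtain x :: "nat \<Rightarrow> nat" where x: "inj x" "\<And>k m n. \<exists>a\<in>range (R (x k)). \<exists>b\<in>range (R (x (Suc k))).
     let W = x ` ({..m} - {k, Suc k}) in a \<in> region n W \<and> (a, b) \<in> conn n W"
    using chain_of_joined_rays by blast
  have region_verts: "region n W \<subseteq> pverts G" for n W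
  proof -
    have "v \<in> pverts G" if "(R 0 0, v) \<in> (parcs G)\<^sup>*" for v
      using that R[of 0] wf by cases (auto simp: rays_def pair_wf_digraph_def)
    then show ?thesis by (auto simp: region_def component_def)
  qed
  interpret linked_rays G "\<lambda>k. R (x k)" L component height
  proof (rule linked_rays.intro)
    fix k m n
    define W where "W = x ` ({..m} - {k, Suc k})"
    obtain a b where ab: "a \<in> range (R (x k))" "b \<in> range (R (x (Suc k)))" "a \<in> region n W" "(a, b) \<in> conn n W"
      using x(2)[of k m n] unfolding W_def Let_def by blast
    obtain p where p: "path_between G (range (R (x k))) p (range (R (x (Suc k))))" "set p \<subseteq> region n W"
      using shortest_path_between[OF ab(4)[unfolded conn_def] ab(1,2) order_refl ab(3) region_verts] by blast
    have "far (parcs G) L (set p) (range (R (x j)))" if "j \<le> m" "j \<noteq> k \<and> j \<noteq> Suc k" for j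
    proof -
      have "set p \<inter> nbhd (x j) = {}" using p(2) that unfolding region_def W_def by blast
      then have "far (parcs G) L (range (R (x j))) (set p)"
        unfolding far_def using nbhdI[of _ "x j"] less_imp_le by blast
      then show ?thesis by (rule far_sym[OF sym])
    qed
    moreover have "set p \<subseteq> component" "\<forall>v\<in>set p. n \<le> height v" using p(2) by (auto simp: region_def)
    ultimately show "\<exists>p. path_between G (range (R (x k))) p (range (R (x (Suc k)))) \<and> set p \<subseteq> component \<and>
      (\<forall>v\<in>set p. n \<le> height v) \<and>
      (\<forall>j\<le>m. j \<noteq> k \<and> j \<noteq> Suc k \<longrightarrow> far (parcs G) L (set p) (range (R (x j))))"
      using p(1) by blast
  next
    fix i j :: nat assume "i \<noteq> j"
    then have "x i \<noteq> x j" using x(1) by (simp add: inj_eq)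
    from rays_far[OF this] show "far (parcs G) L (range (R (x i))) (range (R (x j)))"
      by (rule far_mono) auto
  qed (use assms(1) ray_inj ray_step ray_in_component height_step ray_eventually_high in \<open>auto simp: L_def\<close>)
  obtain V E where "is_fat_model L half_grid G V E" using fat_half_grid_exists by blast
  then have "is_fat_model K half_grid G V E" by (rule is_fat_model_mono) (simp add: L_def)
  then show "\<exists>V E. is_fat_model K half_grid G V E" by blast
qed

end
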